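(* Let $(W,S)$ be a Coxeter system, let $J\subseteq S$, and let $X\subseteq T$ be an order ideal of $(T,\sqsubseteq)$. Then the map $P^J:W\to W$ is order preserving on $(W,\leqslant_{L^X})$: $u\leqslant_{L^X}v$ implies $P^J(u)\leqslant_{L^X}P^J(v)$. In particular, this holds for the $k$-intermediate orders $\leqslant_{L^k}$, for every $k\in\mathbb N$.
   Context: $(W,S)$ is a Coxeter system with length function $\ell$, reflections $T=\{wsw^{-1}:w\in W,\ s\in S\}$ and Bruhat order $\leqslant$. For $X\subseteq T$, $u\leqslant_{L^X}v$ iff $u=v$, or $\ell(u)<\ell(v)$ and there exist $t_1,\dots,t_r\in X$ with $u<t_1u<\dots<t_r\cdots t_1u=v$ in the Bruhat order. For $k\in\mathbb N$, let $T_k=\{t\in T:(\ell(t)-1)/2\leqslant k\}$ and $\leqslant_{L^k}:=\leqslant_{L^{T_k}}$. The Bruhat graph $\Omega_{W,S}$ has vertex set $W$ and an arrow $u\to v$ iff $uv^{-1}\in T$ and $u<v$; $\Omega_{W,S}(Y)$ is its induced subgraph on $Y$. A reflection subgroup $W'$ (a subgroup generated by reflections) has canonical Coxeter generators $S'=\{t\in T:N(t)\cap W'=\{t\}\}$, where $N(v)=\{t\in T:\ell(tv)<\ell(v)\}$; it is dihedral if $|S'|=2$. $t\sqsubseteq' t'$ iff $t=t'$ or there is a dihedral reflection subgroup $W'\ni t,t'$ such that the directed distance from $t$ to $t'$ in $\Omega_{W,S}(W')$ is finite; $\sqsubseteq$ is the transitive closure of $\sqsubseteq'$. For $J\subseteq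 S$, $W_J$ is the subgroup generated by $J$ and $W^J=\{w\in W:\ell(w)<\ell(ws)\ \forall s\in J\}$. Every $w$ factors uniquely as $w=w^Jw_J$ with $w^J\in W^J$, $w_J\in W_J$ and $\ell(w)=\ell(w^J)+\ell(w_J)$. Set $P^J(w):=w^J$. *)

theory Defs
  imports "HOL-Algebra.Algebra"
begin

definition wprod :: "('a, 'b) monoid_scheme \<Rightarrow> 'a list \<Rightarrow> 'a" where
  "wprod G ws = foldr (\<lambda>x y. x \<otimes>\<^bsub>G\<^esub> y) ws \<one>\<^bsub>G\<^esub>"

definition alt_word :: "'a \<Rightarrow> 'a \<Rightarrow> nat \<Rightarrow> 'a list" where
  "alt_word s t n = map (\<lambda>i. if even i then s else t) [0..<n]"

text \<open>One elementary move of the Coxeter presentation: deleting a relator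
  (s t)^m(s,t), where m(s,t) is the (finite) order of st; for s = t this is s s.\<close>
definition cox_move :: "('a, 'b) monoid_scheme \<Rightarrow> 'a set \<Rightarrow> 'a list \<Rightarrow> 'a list \<Rightarrow> bool" where
  "cox_move G S x y \<longleftrightarrow> (\<exists>u v s t. s \<in> S \<and> t \<in> S \<and> group.ord G (s \<otimes>\<^bsub>G\<^esub> t) > 0 \<and>
      x = u @ alt_word s t (2 * group.ord G (s \<otimes>\<^bsub>G\<^esub> t)) @ v \<and> y = u @ v)"

text \<open>(W,S) is a Coxeter system: S is a generating set of involutions of the group W
  and W has the presentation with generators S and relations (st)^m(s,t) = 1,
  i.e. every word in S representing the identity is a consequence of the relators.\<close>
definition coxeter_system :: "('a, 'b) monoid_scheme \<Rightarrow> 'a set \<Rightarrow> bool" where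
  "coxeter_system G S \<longleftrightarrow> group G \<and> S \<subseteq> carrier G \<and> generate G S = carrier G \<and>
     (\<forall>s\<in>S. s \<noteq> \<one>\<^bsub>G\<^esub> \<and> s \<otimes>\<^bsub>G\<^esub> s = \<one>\<^bsub>G\<^esub>) \<and>
     (\<forall>ws \<in> lists S. wprod G ws = \<one>\<^bsub>G\<^esub> \<longrightarrow> equivclp (cox_move G S) ws [])"

definition cox_len :: "('a, 'b) monoid_scheme \<Rightarrow> 'a set \<Rightarrow> 'a \<Rightarrow> nat" where
  "cox_len G S w = (LEAST n. \<exists>ws \<in> lists S. length ws = n \<and> wprod G ws = w)"

definition reflections :: "('a, 'b) monoid_scheme \<Rightarrow> 'a set \<Rightarrow> 'a set" where
  "reflections G S = {w \<otimes>\<^bsub>G\<^esub> s \<otimes>\<^bsub>G\<^esub> inv\<^bsub>G\<^esub> w | w s. w \<in> carrier G \<and> s \<in> S}"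

definition bruhat_step :: "('a, 'b) monoid_scheme \<Rightarrow> 'a set \<Rightarrow> 'a \<Rightarrow> 'a \<Rightarrow> bool" where
  "bruhat_step G S u v \<longleftrightarrow> u \<in> carrier G \<and> v \<in> carrier G \<and>
     (\<exists>t \<in> reflections G S. v = t \<otimes>\<^bsub>G\<^esub> u) \<and> cox_len G S u < cox_len G S v"

definition bruhat_le :: "('a, 'b) monoid_scheme \<Rightarrow> 'a set \<Rightarrow> 'a \<Rightarrow> 'a \<Rightarrow> bool" where
  "bruhat_le G S u v \<longleftrightarrow> u \<in> carrier G \<and> v \<in> carrier G \<and> (bruhat_step G S)\<^sup>*\<^sup>* u v"

definition bruhat_lt :: "('a, 'b) monoid_scheme \<Rightarrow> 'a set \<Rightarrow> 'a \<Rightarrow> 'a \<Rightarrow> bool" where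
  "bruhat_lt G S u v \<longleftrightarrow> bruhat_le G S u v \<and> u \<noteq> v"

definition LX_step :: "('a, 'b) monoid_scheme \<Rightarrow> 'a set \<Rightarrow> 'a set \<Rightarrow> 'a \<Rightarrow> 'a \<Rightarrow> bool" where
  "LX_step G S R x y \<longleftrightarrow> (\<exists>t \<in> R. y = t \<otimes>\<^bsub>G\<^esub> x \<and> bruhat_lt G S x y)"

definition le_LX :: "('a, 'b) monoid_scheme \<Rightarrow> 'a set \<Rightarrow> 'a set \<Rightarrow> 'a \<Rightarrow> 'a \<Rightarrow> bool" where
  "le_LX G S R u v \<longleftrightarrow> u = v \<or> (cox_len G S u < cox_len G S v \<and> (LX_step G S R)\<^sup>+\<^sup>+ u v)"

definition refl_T_k :: "('a, 'b) monoid_scheme \<Rightarrow> 'a set \<Rightarrow> nat \<Rightarrow> 'a set" where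
  "refl_T_k G S k = {t \<in> reflections G S. (real (cox_len G S t) - 1) / 2 \<le> real k}"

definition le_Lk :: "('a, 'b) monoid_scheme \<Rightarrow> 'a set \<Rightarrow> nat \<Rightarrow> 'a \<Rightarrow> 'a \<Rightarrow> bool" where
  "le_Lk G S k = le_LX G S (refl_T_k G S k)"

definition bruhat_arrow :: "('a, 'b) monoid_scheme \<Rightarrow> 'a set \<Rightarrow> 'a \<Rightarrow> 'a \<Rightarrow> bool" where
  "bruhat_arrow G S u v \<longleftrightarrow> u \<otimes>\<^bsub>G\<^esub> inv\<^bsub>G\<^esub> v \<in> reflections G S \<and> bruhat_lt G S u v"

definition bruhat_arrow_on :: "('a, 'b) monoid_scheme \<Rightarrow> 'a set \<Rightarrow> 'a set \<Rightarrow> 'a \<Rightarrow> 'a \<Rightarrow> bool" where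
  "bruhat_arrow_on G S Y u v \<longleftrightarrow> u \<in> Y \<and> v \<in> Y \<and> bruhat_arrow G S u v"

definition left_inversions :: "('a, 'b) monoid_scheme \<Rightarrow> 'a set \<Rightarrow> 'a \<Rightarrow> 'a set" where
  "left_inversions G S v = {t \<in> reflections G S. cox_len G S (t \<otimes>\<^bsub>G\<^esub> v) < cox_len G S v}"

definition reflection_subgroup :: "('a, 'b) monoid_scheme \<Rightarrow> 'a set \<Rightarrow> 'a set \<Rightarrow> bool" where
  "reflection_subgroup G S W' \<longleftrightarrow> (\<exists>R \<subseteq> reflections G S. W' = generate G R)"

definition canonical_gens :: "('a, 'b) monoid_scheme \<Rightarrow> 'a set \<Rightarrow> 'a set \<Rightarrow> 'a set" where
  "canonical_gens G S W' = {t \<in> reflections G S. left_inversions G S t \<inter> W' = {t}}"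

definition dihedral_refl_subgroup :: "('a, 'b) monoid_scheme \<Rightarrow> 'a set \<Rightarrow> 'a set \<Rightarrow> bool" where
  "dihedral_refl_subgroup G S W' \<longleftrightarrow> reflection_subgroup G S W' \<and>
     finite (canonical_gens G S W') \<and> card (canonical_gens G S W') = 2"

definition refl_sq' :: "('a, 'b) monoid_scheme \<Rightarrow> 'a set \<Rightarrow> 'a \<Rightarrow> 'a \<Rightarrow> bool" where
  "refl_sq' G S t t' \<longleftrightarrow> t \<in> reflections G S \<and> t' \<in> reflections G S \<and>
     (t = t' \<or> (\<exists>W'. dihedral_refl_subgroup G S W' \<and> t \<in> W' \<and> t' \<in> W' \<and>
                       (bruhat_arrow_on G S W')\<^sup>*\<^sup>* t t'))"

definition refl_sq :: "('a, 'b) monoid_scheme \<Rightarrow> 'a set \<Rightarrow> 'a \<Rightarrow> 'a \<Rightarrow> bool" where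
  "refl_sq G S = (refl_sq' G S)\<^sup>+\<^sup>+"

definition order_ideal_T :: "('a, 'b) monoid_scheme \<Rightarrow> 'a set \<Rightarrow> 'a set \<Rightarrow> bool" where
  "order_ideal_T G S R \<longleftrightarrow> R \<subseteq> reflections G S \<and>
     (\<forall>t t'. t' \<in> R \<longrightarrow> refl_sq G S t t' \<longrightarrow> t \<in> R)"

definition min_coset_reps :: "('a, 'b) monoid_scheme \<Rightarrow> 'a set \<Rightarrow> 'a set \<Rightarrow> 'a set" where
  "min_coset_reps G S J = {w \<in> carrier G. \<forall>s \<in> J. cox_len G S w < cox_len G S (w \<otimes>\<^bsub>G\<^esub> s)}"

definition proj_J :: "('a, 'b) monoid_scheme \<Rightarrow> 'a set \<Rightarrow> 'a set \<Rightarrow> 'a \<Rightarrow> 'a" where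
  "proj_J G S J w = (THE x. x \<in> min_coset_reps G S J \<and>
     (\<exists>y \<in> generate G J. w = x \<otimes>\<^bsub>G\<^esub> y \<and> cox_len G S w = cox_len G S x + cox_len G S y))"

end

theory Submission
  imports Defs
begin

text \<open>
  Let \<open>N(w)\<close> be the set of reflections whose walls separate \<open>1\<close> from \<open>w\<close>. The parity with which
  the gallery of a word crosses each wall is unchanged by the relators, so \<open>N\<close> is a cocycle: \<open>N(xy)\<close>
  is the symmetric difference of \<open>N(x)\<close> and \<open>x N(y) x\<inverse>\<close>. This yields the exchange property for
  canonical generators, and on a coset of a reflection subgroup \<open>W'\<close> with shortest element \<open>y\<close> it
  shows that \<open>N(hy)\<close> and \<open>N(h)\<close> have the same trace on \<open>W'\<close> for \<open>h\<close> in \<open>W'\<close>.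

  The map \<open>P\<^sup>J\<close> is a composition of maps \<open>w \<mapsto> min(w, ws)\<close> with \<open>s\<close> in \<open>J\<close>, so it suffices to treat
  these, and for a single step \<open>u < tu\<close> the only nontrivial situation is \<open>x < rx < trx < tx\<close> with a
  reflection \<open>r\<close>, where a chain from \<open>x\<close> to \<open>trx\<close> with reflections in \<open>X\<close> is required. These elements
  lie in one coset of the dihedral group \<open>W'\<close> generated by \<open>t\<close> and \<open>r\<close>, hence the question can be
  settled in \<open>W'\<close>. There \<open>X\<close> contains all reflections that are shorter than \<open>t\<close> with respect to the
  canonical generators; in particular it contains these generators, which are enough to climb from a
  suffix of a reduced word to the whole word. At most one jump between the two families of
  alternating words is needed before that climb.
\<close>

section \<open>Words in involutions\<close>

lemma alt_word_0 [simp]: "alt_word x y 0 = []"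
  by (simp add: alt_word_def)

lemma alt_word_Suc [simp]: "alt_word x y (Suc n) = x # alt_word y x n"
  unfolding alt_word_def by (simp add: upt_conv_Cons map_Suc_upt [symmetric] o_def del: upt_Suc)

lemma length_alt_word [simp]: "length (alt_word x y n) = n"
  by (simp add: alt_word_def)

lemma alt_word_in_lists: "x \<in> A \<Longrightarrow> y \<in> A \<Longrightarrow> alt_word x y n \<in> lists A"
  by (induction n arbitrary: x y) auto

lemma rev_in_lists [simp]: "rev ws \<in> lists A \<longleftrightarrow> ws \<in> lists A"
  by (simp add: in_lists_conv_set)

lemma wprod_Nil [simp]: "wprod G [] = \<one>\<^bsub>G\<^esub>"
  and wprod_Cons [simp]: "wprod G (x # xs) = x \<otimes>\<^bsub>G\<^esub> wprod G xs"
  by (simp_all add: wprod_def)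

context group
begin

lemma inv_cancel_left [simp]:
  "x \<in> carrier G \<Longrightarrow> y \<in> carrier G \<Longrightarrow> inv x \<otimes> (x \<otimes> y) = y"
  "x \<in> carrier G \<Longrightarrow> y \<in> carrier G \<Longrightarrow> x \<otimes> (inv x \<otimes> y) = y"
  by (simp_all add: m_assoc [symmetric])

lemma wprod_closed: "ws \<in> lists (carrier G) \<Longrightarrow> wprod G ws \<in> carrier G"
  by (induction ws) auto

lemma wprod_append:
  "us \<in> lists (carrier G) \<Longrightarrow> vs \<in> lists (carrier G) \<Longrightarrow>
    wprod G (us @ vs) = wprod G us \<otimes> wprod G vs"
  by (induction us) (auto simp: m_assoc wprod_closed)

definition involutions :: "'a set \<Rightarrow> bool" where
  "involutions A \<longleftrightarrow> A \<subseteq> carrier G \<and> (\<forall>a\<in>A. a \<otimes> a = \<one>)"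

lemma involutionsD:
  assumes "involutions A" "a \<in> A"
  shows "a \<in> carrier G" "a \<otimes> a = \<one>" "inv a = a"
  using assms by (auto simp: involutions_def intro: inv_equality)

lemma involutions_subset: "involutions A \<Longrightarrow> B \<subseteq> A \<Longrightarrow> involutions B"
  by (auto simp: involutions_def)

lemma involutions_cancel_left:
  "involutions A \<Longrightarrow> a \<in> A \<Longrightarrow> x \<in> carrier G \<Longrightarrow> a \<otimes> (a \<otimes> x) = x"
  by (simp add: involutionsD m_assoc [symmetric])

lemma involutions_wprod_closed: "involutions A \<Longrightarrow> ws \<in> lists A \<Longrightarrow> wprod G ws \<in> carrier G"
  by (rule wprod_closed) (auto simp: involutions_def)

lemma involutions_wprod_append:
  "involutions A \<Longrightarrow> us \<in> lists A \<Longrightarrow> vs \<in> lists A \<Longrightarrow>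
    wprod G (us @ vs) = wprod G us \<otimes> wprod G vs"
  by (rule wprod_append) (auto simp: involutions_def)

lemma inv_wprod:
  "involutions A \<Longrightarrow> ws \<in> lists A \<Longrightarrow> inv (wprod G ws) = wprod G (rev ws)"
proof (induction ws)
  case (Cons a ws)
  then have "a \<in> A" "ws \<in> lists A" by auto
  with Cons show ?case
    using involutionsD [OF Cons.prems(1)] involutions_wprod_closed [OF Cons.prems(1)]
      involutions_wprod_append [OF Cons.prems(1), of "rev ws" "[a]"]
    by (simp add: inv_mult_group)
qed simp

lemma wprod_append_rev:
  assumes "involutions A" "us \<in> lists A" "vs \<in> lists A" "wprod G us = wprod G vs"
  shows "wprod G (us @ rev vs) = \<one>"
  using assms involutions_wprod_append [OF assms(1), of us "rev vs"]
    inv_wprod [OF assms(1,3), symmetric] involutions_wprod_closed [OF assms(1,3)]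
  by simp

lemma generate_eq_wprod:
  assumes "involutions A"
  shows "generate G A = wprod G ` lists A"
proof
  show "generate G A \<subseteq> wprod G ` lists A"
  proof
    fix w assume "w \<in> generate G A"
    then show "w \<in> wprod G ` lists A"
    proof (induction rule: generate.induct)
      case one
      show ?case by (rule image_eqI [of _ _ "[]"]) auto
    next
      case (incl a)
      then show ?case using involutionsD [OF assms] by (intro image_eqI [of _ _ "[a]"]) auto
    next
      case (inv a)
      then show ?case using involutionsD [OF assms] by (intro image_eqI [of _ _ "[a]"]) auto
    next
      case (eng u v)
      then obtain us vs where "us \<in> lists A" "vs \<in> lists A" "u = wprod G us" "v = wprod G vs"
        by blast
      then show ?case
        by (intro image_eqI [of _ _ "us @ vs"]) (auto simp: involutions_wprod_append [OF assms])
    qed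
  qed
  show "wprod G ` lists A \<subseteq> generate G A"
  proof (rule image_subsetI)
    fix ws assume "ws \<in> lists A"
    then show "wprod G ws \<in> generate G A"
      by (induction ws) (auto intro: generate.intros)
  qed
qed

lemma cox_len_wprod_le:
  assumes "ws \<in> lists A"
  shows "cox_len G A (wprod G ws) \<le> length ws"
  unfolding cox_len_def by (rule Least_le) (use assms in blast)

lemma reduced_wordE:
  assumes "involutions A" "w \<in> generate G A"
  obtains ws where "ws \<in> lists A" "length ws = cox_len G A w" "wprod G ws = w"
proof -
  have "\<exists>n. \<exists>ws\<in>lists A. length ws = n \<and> wprod G ws = w"
    using assms generate_eq_wprod by auto
  from LeastI_ex [OF this] show ?thesis
    unfolding cox_len_def [symmetric] using that by blast
qed

lemma cox_len_one [simp]: "cox_len G A \<one> = 0"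
  using cox_len_wprod_le [of "[]" A] by simp

lemma cox_len_mult_le:
  assumes "involutions A" "x \<in> generate G A" "y \<in> generate G A"
  shows "cox_len G A (x \<otimes> y) \<le> cox_len G A x + cox_len G A y"
proof -
  obtain us where "us \<in> lists A" "length us = cox_len G A x" "wprod G us = x"
    using assms(1,2) by (rule reduced_wordE)
  moreover obtain vs where "vs \<in> lists A" "length vs = cox_len G A y" "wprod G vs = y"
    using assms(1,3) by (rule reduced_wordE)
  ultimately show ?thesis
    using cox_len_wprod_le [of "us @ vs" A] involutions_wprod_append [OF assms(1), of us vs] by auto
qed

lemma cox_len_inv:
  assumes "involutions A" "x \<in> generate G A"
  shows "cox_len G A (inv x) = cox_len G A x"
proof (rule antisym)
  have closed: "inv z \<in> generate G A" and le: "cox_len G A (inv z) \<le> cox_len G A z"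
    if z: "z \<in> generate G A" for z
  proof -
    obtain us where "us \<in> lists A" "length us = cox_len G A z" "wprod G us = z"
      using assms(1) z by (rule reduced_wordE)
    then show "inv z \<in> generate G A" "cox_len G A (inv z) \<le> cox_len G A z"
      using cox_len_wprod_le [of "rev us" A] inv_wprod [OF assms(1), of us]
        generate_eq_wprod [OF assms(1)] by auto
  qed
  show "cox_len G A (inv x) \<le> cox_len G A x"
    using assms(2) by (rule le)
  have "x \<in> carrier G"
    using assms by (auto simp: involutions_def intro: generate_in_carrier)
  then show "cox_len G A x \<le> cox_len G A (inv x)"
    using le [OF closed [OF assms(2)]] by simp
qed

lemma cox_len_generator_le:
  assumes "involutions A" "a \<in> A"
  shows "cox_len G A a \<le> 1"
  using cox_len_wprod_le [of "[a]" A] involutionsD [OF assms] assms by simp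

text \<open>Both Bruhat steps in \<open>G\<close> (\<open>A = S\<close>) and their analogues in a reflection subgroup, whose length
  function is that of its canonical generators \<open>A\<close>.\<close>

definition ascent :: "'a set \<Rightarrow> 'a set \<Rightarrow> 'a \<Rightarrow> 'a \<Rightarrow> bool" where
  "ascent A R u v \<longleftrightarrow>
    u \<in> generate G A \<and> (\<exists>t\<in>R. v = t \<otimes> u) \<and> cox_len G A u < cox_len G A v"

end

section \<open>Crossing parities\<close>

text \<open>Parity of the number of times the gallery of a word crosses the wall of the reflection
  \<open>t\<close>.\<close>

primrec crossing_parity :: "('a, 'b) monoid_scheme \<Rightarrow> 'a list \<Rightarrow> 'a \<Rightarrow> bool" where
  "crossing_parity G [] t = False"
| "crossing_parity G (s # ws) t = ((t = s) \<noteq> crossing_parity G ws (s \<otimes>\<^bsub>G\<^esub> t \<otimes>\<^bsub>G\<^esub> s))"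

context group
begin

lemma crossing_parity_append:
  assumes A: "involutions A" and "us \<in> lists A" "t \<in> carrier G"
  shows "crossing_parity G (us @ vs) t \<longleftrightarrow>
    (crossing_parity G us t \<noteq> crossing_parity G vs (inv (wprod G us) \<otimes> t \<otimes> wprod G us))"
  using assms(2,3)
proof (induction us arbitrary: t)
  case (Cons s us)
  then have "s \<in> A" "us \<in> lists A" by auto
  note closed = involutionsD [OF A \<open>s \<in> A\<close>] involutions_wprod_closed [OF A \<open>us \<in> lists A\<close>]
  with Cons.prems have "s \<otimes> t \<otimes> s \<in> carrier G" by simp
  from Cons.IH [OF this] closed Cons.prems show ?case
    by (simp add: inv_mult_group m_assoc) blast
qed simp

lemma crossing_parity_deletion:
  assumes A: "involutions A" and "ws \<in> lists A" "t \<in> carrier G" "crossing_parity G ws t"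
  shows "\<exists>us a vs. ws = us @ a # vs \<and> t \<otimes> wprod G ws = wprod G (us @ vs)"
  using assms(2-)
proof (induction ws arbitrary: t)
  case (Cons s ws)
  then have "s \<in> A" "ws \<in> lists A" by auto
  note closed = involutionsD [OF A \<open>s \<in> A\<close>] involutions_wprod_closed [OF A \<open>ws \<in> lists A\<close>]
  show ?case
  proof (cases "t = s")
    case True
    then have "t \<otimes> wprod G (s # ws) = wprod G ([] @ ws)"
      using closed \<open>s \<in> A\<close> by (simp add: involutions_cancel_left [OF A])
    then show ?thesis by blast
  next
    case False
    then obtain us a vs where split: "ws = us @ a # vs"
      and del: "s \<otimes> t \<otimes> s \<otimes> wprod G ws = wprod G (us @ vs)"
      using Cons.IH [of "s \<otimes> t \<otimes> s"] Cons.prems closed by auto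
    have "t \<otimes> wprod G (s # ws) = s \<otimes> (s \<otimes> t \<otimes> s \<otimes> wprod G ws)"
      using closed Cons.prems \<open>s \<in> A\<close> by (simp add: m_assoc involutions_cancel_left [OF A])
    also have "\<dots> = wprod G ((s # us) @ vs)" by (simp add: del)
    finally have "t \<otimes> wprod G (s # ws) = wprod G ((s # us) @ vs)" .
    moreover have "s # ws = (s # us) @ a # vs" by (simp add: split)
    ultimately show ?thesis by blast
  qed
qed simp

lemma mult_pow_shift:
  assumes "s \<in> carrier G" "t \<in> carrier G"
  shows "s \<otimes> (t \<otimes> s) [^] (i::nat) = (s \<otimes> t) [^] i \<otimes> s"
proof (induction i)
  case (Suc i)
  have "s \<otimes> (t \<otimes> s) [^] Suc i = (s \<otimes> (t \<otimes> s) [^] i) \<otimes> (t \<otimes> s)"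
    using assms by (simp add: m_assoc)
  then show ?case using assms by (simp add: Suc m_assoc)
qed (use assms in simp)

lemma crossing_parity_alt_word:
  assumes "involutions {s, t}" "r \<in> carrier G"
  shows "crossing_parity G (alt_word s t n) r \<longleftrightarrow>
    odd (\<Sum>i<n. of_bool ((s \<otimes> t) [^] i \<otimes> s = r) :: nat)"
  using assms
proof (induction n arbitrary: s t r)
  case (Suc n)
  note st = involutionsD [OF Suc.prems(1), of s, simplified]
    involutionsD [OF Suc.prems(1), of t, simplified]
  have s_cancel: "s \<otimes> (s \<otimes> x) = x" if "x \<in> carrier G" for x
    using Suc.prems(1) that by (simp add: involutions_cancel_left)
  have shift: "(t \<otimes> s) [^] i \<otimes> t = s \<otimes> r \<otimes> s \<longleftrightarrow> (s \<otimes> t) [^] Suc i \<otimes> s = r" for i :: nat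
  proof -
    have "(s \<otimes> t) [^] Suc i \<otimes> s = s \<otimes> ((t \<otimes> s) [^] i \<otimes> t) \<otimes> s"
      using st mult_pow_shift [of s t i, symmetric] by (simp add: m_assoc [symmetric])
    moreover have "x = s \<otimes> r \<otimes> s \<longleftrightarrow> s \<otimes> x \<otimes> s = r" if "x \<in> carrier G" for x
      using st Suc.prems(2) that by (auto simp: m_assoc s_cancel)
    ultimately show ?thesis using st by simp
  qed
  have "involutions {t, s}" "s \<otimes> r \<otimes> s \<in> carrier G"
    using Suc.prems st by (simp_all add: insert_commute)
  from Suc.IH [OF this] show ?case
    unfolding sum.lessThan_Suc_shift shift using st by (auto simp del: nat_pow_Suc)
qed simp

lemma crossing_parity_relator:
  assumes "involutions {s, t}" "r \<in> carrier G"
  shows "\<not> crossing_parity G (alt_word s t (2 * ord (s \<otimes> t))) r"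
proof -
  define m where "m = ord (s \<otimes> t)"
  define f where "f i = (of_bool ((s \<otimes> t) [^] i \<otimes> s = r) :: nat)" for i :: nat
  have "s \<otimes> t \<in> carrier G" using assms(1) by (simp add: involutions_def)
  then have "(s \<otimes> t) [^] (i + m) = (s \<otimes> t) [^] i" for i
    using pow_ord_eq_1 [of "s \<otimes> t"] by (simp add: m_def nat_pow_mult [symmetric])
  then have periodic: "f (i + m) = f i" for i
    by (simp add: f_def)
  have "sum f {..<2 * m} = sum f {..<m} + sum f {m..<m + m}"
    by (simp add: mult_2 lessThan_atLeast0 sum.atLeastLessThan_concat)
  also have "sum f {m..<m + m} = sum f {..<m}"
    using sum.shift_bounds_nat_ivl [of f 0 m m] by (simp add: periodic lessThan_atLeast0)
  finally show ?thesis
    using crossing_parity_alt_word [OF assms, of "2 * m"] by (simp add: m_def f_def)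
qed

lemma wprod_alt_word_even:
  assumes "s \<in> carrier G" "t \<in> carrier G"
  shows "wprod G (alt_word s t (2 * n)) = (s \<otimes> t) [^] n"
proof (induction n)
  case (Suc n)
  have "wprod G (alt_word s t (2 * Suc n)) = (s \<otimes> t) \<otimes> (s \<otimes> t) [^] n"
    using assms by (simp add: Suc m_assoc)
  then show ?case using assms by (metis m_closed nat_pow_Suc2)
qed simp

end

section \<open>Coxeter systems and inversion sets\<close>

locale coxeter =
  fixes G :: "('a, 'b) monoid_scheme" (structure) and S :: "'a set"
  assumes coxeter_system: "coxeter_system G S"

sublocale coxeter \<subseteq> group G
  using coxeter_system by (simp add: coxeter_system_def)

context coxeter
begin

abbreviation len :: "'a \<Rightarrow> nat" where "len \<equiv> cox_len G S"
abbreviation T :: "'a set" where "T \<equiv> reflections G S"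
abbreviation N :: "'a \<Rightarrow> 'a set" where "N \<equiv> left_inversions G S"

lemma generate_S: "generate G S = carrier G"
  using coxeter_system by (simp add: coxeter_system_def)

lemma S_involutions: "involutions S"
  using coxeter_system by (auto simp: coxeter_system_def involutions_def)

lemmas S_square [simp] = involutionsD(2) [OF S_involutions]
  and S_wprod_closed [simp] = involutions_wprod_closed [OF S_involutions]
  and S_wprod_append = involutions_wprod_append [OF S_involutions]

lemma S_closed [simp]: "s \<in> S \<Longrightarrow> s \<in> carrier G"
  by (rule involutionsD(1) [OF S_involutions])

lemma S_cancel: "s \<in> S \<Longrightarrow> x \<in> carrier G \<Longrightarrow> s \<otimes> (s \<otimes> x) = x"
  by (rule involutions_cancel_left [OF S_involutions])

lemma reflectionE:
  assumes "t \<in> T" obtains p s where "p \<in> carrier G" "s \<in> S" "t = p \<otimes> s \<otimes> inv p"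
  using assms unfolding reflections_def by blast

lemma S_subset_T: "S \<subseteq> T"
proof
  fix s assume "s \<in> S"
  then show "s \<in> T"
    unfolding reflections_def by (intro CollectI exI [of _ \<one>] exI [of _ s]) simp
qed

lemma T_involutions: "involutions T"
  unfolding involutions_def
proof (intro conjI subsetI ballI)
  fix t assume "t \<in> T"
  then obtain p s where "p \<in> carrier G" "s \<in> S" "t = p \<otimes> s \<otimes> inv p" by (rule reflectionE)
  then show "t \<in> carrier G" "t \<otimes> t = \<one>" by (simp_all add: m_assoc S_cancel)
qed

lemmas T_closed [simp] = involutionsD(1) [OF T_involutions]
  and T_square [simp] = involutionsD(2) [OF T_involutions]
  and T_inv [simp] = involutionsD(3) [OF T_involutions]
  and T_cancel [simp] = involutions_cancel_left [OF T_involutions]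
  and T_subset_involutions = involutions_subset [OF T_involutions]

lemma T_conj:
  assumes "t \<in> T" "x \<in> carrier G" shows "x \<otimes> t \<otimes> inv x \<in> T"
proof -
  obtain p s where "p \<in> carrier G" "s \<in> S" "t = p \<otimes> s \<otimes> inv p" using assms(1) by (rule reflectionE)
  then show ?thesis using assms(2) unfolding reflections_def
    by (intro CollectI exI [of _ "x \<otimes> p"] exI [of _ s]) (simp add: inv_mult_group m_assoc)
qed

lemma T_conj_inv: "t \<in> T \<Longrightarrow> x \<in> carrier G \<Longrightarrow> inv x \<otimes> t \<otimes> x \<in> T"
  using T_conj [of t "inv x"] by simp

lemma S_wordE:
  assumes "w \<in> carrier G" obtains ws where "ws \<in> lists S" "length ws = len w" "wprod G ws = w"
  using assms reduced_wordE [OF S_involutions] generate_S by auto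

lemma crossing_parity_delete_relator:
  assumes st: "s \<in> S" "t \<in> S" and us: "us \<in> lists S" and r: "r \<in> carrier G"
  shows "crossing_parity G (us @ alt_word s t (2 * ord (s \<otimes> t)) @ vs) r \<longleftrightarrow>
    crossing_parity G (us @ vs) r"
proof -
  let ?R = "alt_word s t (2 * ord (s \<otimes> t))"
  have R: "?R \<in> lists S" "involutions {s, t}" "wprod G ?R = \<one>"
    using st by (simp_all add: alt_word_in_lists involutions_subset [OF S_involutions]
      wprod_alt_word_even)
  have "crossing_parity G (?R @ vs) q \<longleftrightarrow> crossing_parity G vs q" if "q \<in> carrier G" for q
    using that R crossing_parity_append [OF S_involutions R(1) that]
      crossing_parity_relator [OF R(2) that] by simp
  then show ?thesis
    using us r by (simp add: crossing_parity_append [OF S_involutions])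
qed

lemma cox_move_invariants:
  assumes "cox_move G S x y"
  shows "x \<in> lists S \<longleftrightarrow> y \<in> lists S"
    and "even (length x) \<longleftrightarrow> even (length y)"
    and "x \<in> lists S \<Longrightarrow> r \<in> carrier G \<Longrightarrow> crossing_parity G x r \<longleftrightarrow> crossing_parity G y r"
proof -
  obtain us vs s t where st: "s \<in> S" "t \<in> S"
    and x: "x = us @ alt_word s t (2 * ord (s \<otimes> t)) @ vs" and y: "y = us @ vs"
    using assms unfolding cox_move_def by blast
  show "x \<in> lists S \<longleftrightarrow> y \<in> lists S"
    using alt_word_in_lists [OF st] unfolding x y append_in_lists_conv by blast
  show "even (length x) \<longleftrightarrow> even (length y)" by (simp add: x y)
  assume "x \<in> lists S" "r \<in> carrier G"
  then show "crossing_parity G x r \<longleftrightarrow> crossing_parity G y r"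
    using crossing_parity_delete_relator [OF st] unfolding x y by simp
qed

lemma
  assumes "ws \<in> lists S" "wprod G ws = \<one>"
  shows even_length_trivial_word: "even (length ws)"
    and crossing_parity_trivial_word: "r \<in> carrier G \<Longrightarrow> \<not> crossing_parity G ws r"
proof -
  have "equivclp (cox_move G S) ws []"
    using assms coxeter_system by (simp add: coxeter_system_def)
  then have "(ws \<in> lists S \<longleftrightarrow> [] \<in> lists S) \<and> (even (length ws) \<longleftrightarrow> even (length ([]::'a list))) \<and>
     (\<forall>r\<in>carrier G. crossing_parity G ws r \<longleftrightarrow> crossing_parity G [] r)"
    unfolding equivclp_def
  proof (induction rule: converse_rtranclp_induct)
    case (step x y)
    from step.hyps(1) consider "cox_move G S x y" | "cox_move G S y x"
      by (auto simp: symclp_def)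
    then show ?case
      by cases (use step.IH cox_move_invariants in \<open>(metis lists.Nil)+\<close>)
  qed simp
  then show "even (length ws)" "r \<in> carrier G \<Longrightarrow> \<not> crossing_parity G ws r" by auto
qed

lemma even_length_cong:
  assumes "us \<in> lists S" "vs \<in> lists S" "wprod G us = wprod G vs"
  shows "even (length us) \<longleftrightarrow> even (length vs)"
  using even_length_trivial_word [OF _ wprod_append_rev [OF S_involutions assms]] assms by simp

lemma crossing_parity_cong:
  assumes "us \<in> lists S" "vs \<in> lists S" "wprod G us = wprod G vs" "r \<in> carrier G"
  shows "crossing_parity G us r \<longleftrightarrow> crossing_parity G vs r"
proof -
  have "\<not> crossing_parity G (ws @ rev vs) r" if "ws \<in> lists S" "wprod G ws = wprod G vs" for ws
    using crossing_parity_trivial_word [OF _ wprod_append_rev [OF S_involutions _ assms(2)]] that assms by simp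
  from this [of us] this [of vs] show ?thesis
    using assms by (auto simp: crossing_parity_append [OF S_involutions])
qed

lemma even_len_wprod_S: "ws \<in> lists S \<Longrightarrow> even (len (wprod G ws)) \<longleftrightarrow> even (length ws)"
  by (metis S_wprod_closed S_wordE even_length_cong)

lemma even_len_mult:
  assumes "x \<in> carrier G" "y \<in> carrier G"
  shows "even (len (x \<otimes> y)) \<longleftrightarrow> (even (len x) \<longleftrightarrow> even (len y))"
proof -
  obtain us vs where "us \<in> lists S" "wprod G us = x" "vs \<in> lists S" "wprod G vs = y"
    by (metis assms S_wordE)
  then show ?thesis
    using even_len_wprod_S [of "us @ vs"] even_len_wprod_S [of us] even_len_wprod_S [of vs]
    by (auto simp: S_wprod_append)
qed

lemma len_inv: "x \<in> carrier G \<Longrightarrow> len (inv x) = len x"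
  by (simp add: cox_len_inv [OF S_involutions] generate_S)

lemma odd_len_S: "s \<in> S \<Longrightarrow> odd (len s)"
  using even_len_wprod_S [of "[s]"] by simp

lemma odd_len_T: "t \<in> T \<Longrightarrow> odd (len t)"
  by (elim reflectionE) (auto simp: even_len_mult len_inv odd_len_S)

lemma one_not_in_T: "\<one> \<notin> T"
  using odd_len_T [of \<one>] by auto

lemma even_len_wprod: "ws \<in> lists T \<Longrightarrow> even (len (wprod G ws)) \<longleftrightarrow> even (length ws)"
  by (induction ws) (auto simp: even_len_mult odd_len_T involutions_wprod_closed [OF T_involutions])

lemma even_cox_len:
  assumes "A \<subseteq> T" "w \<in> generate G A"
  shows "even (cox_len G A w) \<longleftrightarrow> even (len w)"
proof -
  obtain ws where "ws \<in> lists A" "length ws = cox_len G A w" "wprod G ws = w"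
    using T_subset_involutions [OF assms(1)] assms(2) by (rule reduced_wordE)
  then show ?thesis using even_len_wprod [of ws] assms(1) by auto
qed

lemma len_mult_S:
  assumes "x \<in> carrier G" "s \<in> S"
  shows "len (x \<otimes> s) = len x + 1 \<or> len x = len (x \<otimes> s) + 1"
proof -
  have le: "len (z \<otimes> s) \<le> len z + 1" if "z \<in> carrier G" for z
    using cox_len_mult_le [OF S_involutions, of z s] cox_len_generator_le [OF S_involutions, of s]
      that assms by (simp add: generate_S)
  have "even (len (x \<otimes> s)) \<noteq> even (len x)"
    using assms by (simp add: even_len_mult odd_len_S)
  then have "len (x \<otimes> s) \<noteq> len x" by auto
  moreover have "len x \<le> len (x \<otimes> s) + 1"
    using le [of "x \<otimes> s"] assms by (simp add: m_assoc)
  ultimately show ?thesis using le [OF assms(1)] by linarith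
qed

lemma right_descentE:
  assumes "w \<in> carrier G" "w \<noteq> \<one>"
  obtains s where "s \<in> S" "len (w \<otimes> s) < len w"
proof -
  obtain ws where ws: "ws \<in> lists S" "length ws = len w" "wprod G ws = w"
    using assms(1) by (rule S_wordE)
  then obtain us s where us: "ws = us @ [s]" using assms(2) by (cases ws rule: rev_cases) auto
  then have S: "us \<in> lists S" "s \<in> S" using ws(1) by simp_all
  then have "w \<otimes> s = wprod G us"
    using ws(3) S_wprod_append [of us "[s]"] by (simp add: us flip: ws(3)) (simp add: m_assoc)
  then have "len (w \<otimes> s) < len w" using ws(2) us cox_len_wprod_le [OF S(1)] by simp
  then show ?thesis using that S(2) by simp
qed

lemma crossing_parity_self:
  assumes "t \<in> T"
  shows "\<exists>ws\<in>lists S. wprod G ws = t \<and> crossing_parity G ws t"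
proof -
  obtain p s where p: "p \<in> carrier G" "s \<in> S" and t: "t = p \<otimes> s \<otimes> inv p"
    using assms by (rule reflectionE)
  obtain us where us: "us \<in> lists S" "wprod G us = p" using p(1) by (rule S_wordE)
  have conj: "inv p \<otimes> t \<otimes> p = s" using p by (simp add: t m_assoc)
  have rev: "crossing_parity G (rev us) s \<longleftrightarrow> crossing_parity G us t"
    using crossing_parity_trivial_word [OF _ wprod_append_rev [OF S_involutions us(1) us(1) refl], of t]
      crossing_parity_append [OF S_involutions us(1), of t "rev us"] us assms conj by simp
  have "crossing_parity G (us @ s # rev us) t"
    using crossing_parity_append [OF S_involutions us(1), of t "s # rev us"] us assms conj rev p
    by (simp add: m_assoc)
  moreover have "wprod G (us @ s # rev us) = t"
    using us p S_wprod_append [of us "s # rev us"] inv_wprod [OF S_involutions us(1)]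
    by (simp add: t m_assoc)
  ultimately show ?thesis using us p by (intro bexI [of _ "us @ s # rev us"]) auto
qed

lemma left_inversions_iff: "t \<in> N w \<longleftrightarrow> t \<in> T \<and> len (t \<otimes> w) < len w"
  by (simp add: left_inversions_def)

lemma left_inversions_subset: "N w \<subseteq> T"
  by (auto simp: left_inversions_iff)

lemma left_inversions_wprod:
  assumes ws: "ws \<in> lists S" and t: "t \<in> T"
  shows "t \<in> N (wprod G ws) \<longleftrightarrow> crossing_parity G ws t"
proof
  have shorter: "len (t \<otimes> wprod G vs) < len (wprod G vs)"
    if vs: "vs \<in> lists S" and "crossing_parity G vs t" for vs
  proof -
    obtain red where red: "red \<in> lists S" "length red = len (wprod G vs)" "wprod G red = wprod G vs"
      using S_wprod_closed [OF vs] by (rule S_wordE)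
    then have "crossing_parity G red t" using that t crossing_parity_cong [of red vs] by simp
    from crossing_parity_deletion [OF S_involutions red(1) T_closed [OF t] this]
    obtain us a us' where split: "red = us @ a # us'" "t \<otimes> wprod G red = wprod G (us @ us')"
      by blast
    then have "len (t \<otimes> wprod G red) \<le> length (us @ us')"
      using red(1) cox_len_wprod_le [of "us @ us'" S] by simp
    then show ?thesis using red(2,3) split(1) by simp
  qed
  show "t \<in> N (wprod G ws)" if "crossing_parity G ws t"
    using shorter [OF ws that] t by (simp add: left_inversions_iff)
  show "crossing_parity G ws t" if less: "t \<in> N (wprod G ws)"
  proof (rule ccontr)
    assume "\<not> crossing_parity G ws t"
    moreover obtain ts where ts: "ts \<in> lists S" "wprod G ts = t" "crossing_parity G ts t"
      using crossing_parity_self [OF t] by blast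
    ultimately have "crossing_parity G (ts @ ws) t"
      using crossing_parity_append [OF S_involutions ts(1), of t ws] t by simp
    then have "len (t \<otimes> (t \<otimes> wprod G ws)) < len (t \<otimes> wprod G ws)"
      using shorter [of "ts @ ws"] ts ws by (simp add: S_wprod_append)
    then show False using less ws t by (simp add: left_inversions_iff)
  qed
qed

lemma left_inversions_mult:
  assumes "x \<in> carrier G" "y \<in> carrier G" "t \<in> T"
  shows "t \<in> N (x \<otimes> y) \<longleftrightarrow> (t \<in> N x) \<noteq> (inv x \<otimes> t \<otimes> x \<in> N y)"
proof -
  obtain us vs where "us \<in> lists S" "wprod G us = x" "vs \<in> lists S" "wprod G vs = y"
    by (metis assms(1,2) S_wordE)
  then show ?thesis
    using left_inversions_wprod [of "us @ vs" t] left_inversions_wprod [of us t]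
      left_inversions_wprod [of vs "inv x \<otimes> t \<otimes> x"] assms
      crossing_parity_append [OF S_involutions, of us t vs]
    by (simp add: S_wprod_append T_conj_inv)
qed

lemma left_inversions_one [simp]: "N \<one> = {}"
  by (auto simp: left_inversions_def)

lemma left_inversions_S: "s \<in> S \<Longrightarrow> N s = {s}"
  using left_inversions_wprod [of "[s]"] S_subset_T by (auto simp: left_inversions_def)

lemma T_in_left_inversions: "t \<in> T \<Longrightarrow> t \<in> N t"
  using odd_len_T [of t] by (auto simp: left_inversions_iff intro: odd_pos)

lemma left_inversions_mult_self:
  "t \<in> T \<Longrightarrow> x \<in> carrier G \<Longrightarrow> t \<in> N (t \<otimes> x) \<longleftrightarrow> t \<notin> N x"
  using left_inversions_mult [of t x t] by (simp add: T_in_left_inversions m_assoc)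

lemma not_left_inversion_iff:
  "w \<in> carrier G \<Longrightarrow> t \<in> T \<Longrightarrow> t \<notin> N w \<longleftrightarrow> len w < len (t \<otimes> w)"
  using left_inversions_mult_self [of t w] by (simp add: left_inversions_iff)

lemma left_inversion_inv_iff:
  "w \<in> carrier G \<Longrightarrow> t \<in> T \<Longrightarrow> t \<in> N (inv w) \<longleftrightarrow> len (w \<otimes> t) < len w"
  using len_inv [of "w \<otimes> t"] by (simp add: left_inversions_iff len_inv inv_mult_group)

lemma left_inversions_mult_S:
  assumes "w \<in> carrier G" "s \<in> S" "len w < len (w \<otimes> s)"
  shows "N (w \<otimes> s) = insert (w \<otimes> s \<otimes> inv w) (N w)"
proof -
  let ?p = "w \<otimes> s \<otimes> inv w"
  have p: "?p \<in> T" using assms T_conj S_subset_T by blast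
  have "?p \<otimes> w = w \<otimes> s" using assms by (simp add: m_assoc)
  then have "?p \<notin> N w" using assms p by (simp add: not_left_inversion_iff)
  moreover have "inv w \<otimes> t \<otimes> w = s \<longleftrightarrow> t = ?p" if "t \<in> T" for t
    using assms that by (auto simp: m_assoc)
  ultimately show ?thesis
    using assms p left_inversions_mult [of w s] left_inversions_S [of s]
    by (auto simp: left_inversions_iff)
qed

end

section \<open>Canonical generators of reflection subgroups\<close>

context coxeter
begin

lemma canonical_gens_iff: "t \<in> canonical_gens G S H \<longleftrightarrow> t \<in> T \<and> N t \<inter> H = {t}"
  by (simp add: canonical_gens_def)

lemma canonical_gens_subset: "canonical_gens G S H \<subseteq> T \<inter> H"
  by (auto simp: canonical_gens_iff)

lemma left_inversions_coset:
  assumes "subgroup H G" "y \<in> carrier G" "N y \<inter> H = {}" "h \<in> H" "c \<in> T" "c \<in> H"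
  shows "c \<in> N (h \<otimes> y) \<longleftrightarrow> c \<in> N h"
proof -
  have "h \<in> carrier G" using assms(1,4) subgroup.mem_carrier by metis
  moreover have "inv h \<otimes> c \<otimes> h \<in> H"
    using assms(1,4,6) by (simp add: subgroup.m_closed subgroup.m_inv_closed)
  ultimately show ?thesis using left_inversions_mult [of h y c] assms by blast
qed

lemma conj_generator_canonical:
  assumes H: "subgroup H G" and y: "y \<in> carrier G" "N y \<inter> H = {}" and s: "s \<in> S"
    and p: "y \<otimes> s \<otimes> inv y \<in> H"
  shows "y \<otimes> s \<otimes> inv y \<in> canonical_gens G S H"
proof -
  let ?p = "y \<otimes> s \<otimes> inv y"
  have pT: "?p \<in> T" using y s T_conj S_subset_T by blast
  have "c \<in> N ?p \<longleftrightarrow> c = ?p" if c: "c \<in> T" "c \<in> H" for c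
  proof -
    have "c \<in> N ?p \<longleftrightarrow> c \<in> N (?p \<otimes> y)"
      using left_inversions_coset [OF H y p c] by simp
    also have "?p \<otimes> y = y \<otimes> s" using y s by (simp add: m_assoc)
    also have "c \<in> N (y \<otimes> s) \<longleftrightarrow> inv y \<otimes> c \<otimes> y = s"
      using left_inversions_mult [of y s c] y s c left_inversions_S [of s] by auto
    also have "\<dots> \<longleftrightarrow> c = ?p"
      using y s c by (auto simp: m_assoc)
    finally show ?thesis .
  qed
  then show ?thesis
    using pT p left_inversions_subset [of ?p] by (auto simp: canonical_gens_iff)
qed

text \<open>The first wall of a reflection in \<open>H\<close> that is crossed by a gallery from \<open>1\<close> to \<open>w\<close> belongs to
  a canonical generator.\<close>

lemma ex_canonical_left_inversion:
  assumes H: "subgroup H G" and "w \<in> carrier G" "N w \<inter> H \<noteq> {}"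
  shows "N w \<inter> canonical_gens G S H \<noteq> {}"
  using assms(2,3)
proof (induction "len w" arbitrary: w rule: less_induct)
  case less
  then have "w \<noteq> \<one>" by auto
  then obtain s where s: "s \<in> S" "len (w \<otimes> s) < len w"
    using less.prems(1) right_descentE by blast
  define v where "v = w \<otimes> s"
  have v: "v \<in> carrier G" "v \<otimes> s = w" "len v < len w"
    using s less.prems by (simp_all add: v_def m_assoc)
  have N_w: "N w = insert (v \<otimes> s \<otimes> inv v) (N v)"
    using left_inversions_mult_S [OF v(1) s(1)] v by simp
  show ?case
  proof (cases "N v \<inter> H = {}")
    case True
    then have "v \<otimes> s \<otimes> inv v \<in> H" using less.prems N_w by auto
    then show ?thesis using conj_generator_canonical [OF H v(1) True s(1)] N_w by blast
  next
    case False
    then show ?thesis using less.hyps [OF v(3,1)] N_w by blast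
  qed
qed

lemma shortest_coset_repE:
  assumes K: "subgroup K G" and x: "x \<in> carrier G"
  obtains k y where "k \<in> K" "y \<in> carrier G" "x = k \<otimes> y" "N y \<inter> K = {}"
proof -
  let ?P = "\<lambda>y. y \<in> carrier G \<and> (\<exists>k\<in>K. x = k \<otimes> y)"
  have "?P x" using x subgroup.one_closed [OF K] by force
  then obtain y where y: "?P y" and shortest: "\<And>z. ?P z \<Longrightarrow> len y \<le> len z"
    using ex_has_least_nat [of ?P x len] by blast
  then obtain k where k: "k \<in> K" "x = k \<otimes> y" by blast
  have "c \<notin> N y" if c: "c \<in> K" for c
  proof
    assume N: "c \<in> N y"
    then have "c \<in> T" "len (c \<otimes> y) < len y" by (auto simp: left_inversions_iff)
    moreover have "k \<in> carrier G" using K k(1) by (rule subgroup.mem_carrier)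
    ultimately have "x = k \<otimes> c \<otimes> (c \<otimes> y)" "c \<otimes> y \<in> carrier G"
      using y k(2) by (simp_all add: m_assoc)
    then have "?P (c \<otimes> y)" using subgroup.m_closed [OF K k(1) c] by blast
    then show False using shortest \<open>len (c \<otimes> y) < len y\<close> by force
  qed
  then show ?thesis using that [OF k(1) _ k(2)] y by blast
qed

lemma reflection_in_generate_canonical:
  assumes H: "subgroup H G" and t: "t \<in> T" "t \<in> H"
  shows "t \<in> generate G (canonical_gens G S H)"
proof -
  define K where "K = generate G (canonical_gens G S H)"
  have C: "canonical_gens G S H \<subseteq> carrier G" using canonical_gens_subset [of H] by auto
  have K: "subgroup K G" unfolding K_def using C by (rule generate_is_subgroup)
  have KH: "K \<subseteq> H"
    unfolding K_def using canonical_gens_subset [of H] H by (intro generate_subgroup_incl) auto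
  obtain p s where p: "p \<in> carrier G" "s \<in> S" "t = p \<otimes> s \<otimes> inv p" using t(1) by (rule reflectionE)
  obtain k y where k: "k \<in> K" and y: "y \<in> carrier G" "p = k \<otimes> y" "N y \<inter> K = {}"
    using K p(1) by (rule shortest_coset_repE)
  have kG: "k \<in> carrier G" using K k by (rule subgroup.mem_carrier)
  have N_y: "N y \<inter> H = {}"
  proof (rule ccontr)
    assume "\<not> ?thesis"
    then have "N y \<inter> canonical_gens G S H \<noteq> {}" by (rule ex_canonical_left_inversion [OF H y(1)])
    then show False using y(3) unfolding K_def by (auto intro: generate.incl)
  qed
  have t_conj: "t = k \<otimes> (y \<otimes> s \<otimes> inv y) \<otimes> inv k"
    using p y kG by (simp add: inv_mult_group m_assoc)
  then have "y \<otimes> s \<otimes> inv y = inv k \<otimes> t \<otimes> k"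
    using y kG p(2) by (simp add: m_assoc)
  then have "y \<otimes> s \<otimes> inv y \<in> H"
    using k KH t(2) H by (auto simp: subgroup.m_closed subgroup.m_inv_closed)
  then have "y \<otimes> s \<otimes> inv y \<in> canonical_gens G S H"
    by (rule conj_generator_canonical [OF H y(1) N_y p(2)])
  then have "y \<otimes> s \<otimes> inv y \<in> K"
    unfolding K_def by (rule generate.incl)
  then have "t \<in> K"
    unfolding t_conj using k K by (simp add: subgroup.m_closed subgroup.m_inv_closed)
  then show ?thesis by (simp add: K_def)
qed

lemma generate_canonical_gens:
  assumes "R \<subseteq> T"
  shows "generate G (canonical_gens G S (generate G R)) = generate G R"
proof
  have H: "subgroup (generate G R) G" using assms by (intro generate_is_subgroup) auto
  then show "generate G (canonical_gens G S (generate G R)) \<subseteq> generate G R"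
    using canonical_gens_subset [of "generate G R"] by (intro generate_subgroup_incl) auto
  have "R \<subseteq> generate G (canonical_gens G S (generate G R))"
    using reflection_in_generate_canonical [OF H] assms by (auto intro: generate.incl)
  moreover have "subgroup (generate G (canonical_gens G S (generate G R))) G"
    using canonical_gens_subset [of "generate G R"] by (intro generate_is_subgroup) auto
  ultimately show "generate G R \<subseteq> generate G (canonical_gens G S (generate G R))"
    by (rule generate_subgroup_incl)
qed

end

text \<open>By \<open>canonical_gens_eq\<close> below, the inclusion already makes \<open>A\<close> the set of all canonical generators
  of \<open>H\<close>.\<close>

locale canonical_generators = coxeter +
  fixes A :: "'a set"
  assumes A_canonical: "A \<subseteq> canonical_gens G S (generate G A)"
begin

abbreviation H :: "'a set" where "H \<equiv> generate G A"
abbreviation hlen :: "'a \<Rightarrow> nat" where "hlen \<equiv> cox_len G A"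

lemma A_subset_T: "A \<subseteq> T"
  using A_canonical canonical_gens_subset [of H] by blast

lemma A_involutions: "involutions A"
  using A_subset_T by (rule T_subset_involutions)

lemma A_subset_H: "A \<subseteq> H"
  by (auto intro: generate.incl)

lemma H_subgroup: "subgroup H G"
  using A_subset_T by (intro generate_is_subgroup) auto

lemmas H_closed [simp] = subgroup.mem_carrier [OF H_subgroup]
  and H_mult [simp] = subgroup.m_closed [OF H_subgroup]
  and H_inv [simp] = subgroup.m_inv_closed [OF H_subgroup]

lemma even_hlen: "w \<in> H \<Longrightarrow> even (hlen w) \<longleftrightarrow> even (len w)"
  by (rule even_cox_len [OF A_subset_T])

lemma left_inversions_A: "a \<in> A \<Longrightarrow> c \<in> H \<Longrightarrow> c \<in> N a \<longleftrightarrow> c = a"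
  using A_canonical canonical_gens_iff [of a H] by blast

lemma left_inversions_wprod_A:
  assumes "ws \<in> lists A" "c \<in> T" "c \<in> H"
  shows "c \<in> N (wprod G ws) \<longleftrightarrow> crossing_parity G ws c"
  using assms
proof (induction ws arbitrary: c)
  case (Cons a ws)
  then have a: "a \<in> A" "a \<in> T" "a \<in> H" and ws: "ws \<in> lists A"
    using A_subset_T A_subset_H by auto
  have "wprod G ws \<in> carrier G" using ws by (rule involutions_wprod_closed [OF A_involutions])
  moreover have "a \<otimes> c \<otimes> a \<in> T" "a \<otimes> c \<otimes> a \<in> H"
    using a Cons.prems T_conj [of c a] by simp_all
  ultimately show ?case
    using Cons.IH [of "a \<otimes> c \<otimes> a"] left_inversions_mult [of a "wprod G ws" c] left_inversions_A a Cons.prems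
    by simp
qed simp

lemma deletion:
  assumes "ws \<in> lists A" "c \<in> H" "c \<in> N (wprod G ws)"
  shows "\<exists>us a vs. ws = us @ a # vs \<and> c \<otimes> wprod G ws = wprod G (us @ vs)"
proof (rule crossing_parity_deletion [OF A_involutions assms(1)])
  have "c \<in> T" using assms(3) left_inversions_subset by blast
  then show "c \<in> carrier G" "crossing_parity G ws c"
    using left_inversions_wprod_A assms by simp_all
qed

lemma left_inversion_hlen_iff:
  assumes w: "w \<in> H" and c: "c \<in> T" "c \<in> H"
  shows "c \<in> N w \<longleftrightarrow> hlen (c \<otimes> w) < hlen w"
proof
  have shorter: "hlen (c \<otimes> v) < hlen v" if v: "v \<in> H" "c \<in> N v" for v
  proof -
    obtain ws where ws: "ws \<in> lists A" "length ws = hlen v" "wprod G ws = v"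
      using A_involutions v(1) by (rule reduced_wordE)
    then obtain us a vs where split: "ws = us @ a # vs" "c \<otimes> wprod G ws = wprod G (us @ vs)"
      using deletion [OF ws(1) c(2)] v(2) by blast
    then have "hlen (c \<otimes> wprod G ws) \<le> length (us @ vs)"
      using ws(1) cox_len_wprod_le [of "us @ vs" A] by simp
    then show ?thesis using ws(2,3) split(1) by simp
  qed
  show "hlen (c \<otimes> w) < hlen w" if "c \<in> N w"
    using w that by (rule shorter)
  show "c \<in> N w" if "hlen (c \<otimes> w) < hlen w"
    using shorter [of "c \<otimes> w"] left_inversions_mult_self [of c w] that w c by fastforce
qed

lemma not_left_inversion_hlen_iff:
  assumes "w \<in> H" "c \<in> T" "c \<in> H"
  shows "c \<notin> N w \<longleftrightarrow> hlen w < hlen (c \<otimes> w)"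
  using left_inversion_hlen_iff [of "c \<otimes> w" c] left_inversions_mult_self [of c w] assms by simp

lemma coset_len_less_iff:
  assumes y: "y \<in> carrier G" "N y \<inter> H = {}" and h: "h \<in> H" and c: "c \<in> T" "c \<in> H"
  shows "len (h \<otimes> y) < len (c \<otimes> (h \<otimes> y)) \<longleftrightarrow> hlen h < hlen (c \<otimes> h)"
proof -
  have "len (h \<otimes> y) < len (c \<otimes> (h \<otimes> y)) \<longleftrightarrow> c \<notin> N (h \<otimes> y)"
    using h y c not_left_inversion_iff by simp
  also have "\<dots> \<longleftrightarrow> hlen h < hlen (c \<otimes> h)"
    using left_inversions_coset [OF H_subgroup y h c] not_left_inversion_hlen_iff [OF h c] by simp
  finally show ?thesis .
qed

lemma ex_generator_left_inversion:
  assumes "h \<in> H" "h \<noteq> \<one>"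
  shows "\<exists>a\<in>A. a \<in> N h"
proof -
  obtain ws where ws: "ws \<in> lists A" "length ws = hlen h" "wprod G ws = h"
    using A_involutions assms(1) by (rule reduced_wordE)
  then obtain a us where split: "ws = a # us" using assms(2) by (cases ws) auto
  then have a: "a \<in> A" "a \<in> T" "a \<in> H" and us: "us \<in> lists A"
    using ws(1) A_subset_T A_subset_H by auto
  have "a \<otimes> h = wprod G us"
    using ws(3) a(2) involutions_wprod_closed [OF A_involutions us] by (auto simp: split)
  then have "hlen (a \<otimes> h) < hlen h"
    using cox_len_wprod_le [OF us] ws(2) by (simp add: split)
  then show ?thesis using left_inversion_hlen_iff [OF assms(1) a(2,3)] a(1) by blast
qed

lemma canonical_gens_eq: "canonical_gens G S H = A"
proof
  show "canonical_gens G S H \<subseteq> A"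
  proof
    fix c assume c: "c \<in> canonical_gens G S H"
    then have "c \<in> H" "c \<noteq> \<one>" "N c \<inter> H = {c}"
      using one_not_in_T by (auto simp: canonical_gens_iff)
    moreover from this obtain a where "a \<in> A" "a \<in> N c" using ex_generator_left_inversion by blast
    ultimately show "c \<in> A" using A_subset_H by auto
  qed
qed (rule A_canonical)

lemma shortest_coset_rep_unique:
  assumes "z \<in> carrier G" "N z \<inter> H = {}" "h \<in> H" "N (h \<otimes> z) \<inter> H = {}"
  shows "h = \<one>"
proof (rule ccontr)
  assume "h \<noteq> \<one>"
  then obtain a where "a \<in> A" "a \<in> N h" using ex_generator_left_inversion assms(3) by blast
  then show False
    using left_inversions_coset [OF H_subgroup assms(1-3), of a] assms(4) A_subset_T A_subset_H
    by blast
qed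

end

section \<open>Dihedral groups\<close>

context group
begin

text \<open>The alternating products of \<open>a\<close> and \<open>b\<close>, indexed by the position of the corresponding chamber:
  \<open>\<bar>i\<bar>\<close> is the number of letters, and the word starts with \<open>a\<close> if \<open>i > 0\<close> and with \<open>b\<close> if
  \<open>i < 0\<close>. A reflection then acts by \<open>i \<mapsto> k - i\<close> for an odd \<open>k\<close>.\<close>

definition dihedral_elt :: "'a \<Rightarrow> 'a \<Rightarrow> int \<Rightarrow> 'a" where
  "dihedral_elt a b i =
    (if even i then (a \<otimes> b) [^] (i div 2) else (a \<otimes> b) [^] (i div 2) \<otimes> a)"

context
  fixes a b assumes ab: "involutions {a, b}"
begin

lemma involution_pair_simps:
  "a \<in> carrier G" "b \<in> carrier G" "inv a = a" "inv b = b"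
  "x \<in> carrier G \<Longrightarrow> a \<otimes> (a \<otimes> x) = x" "x \<in> carrier G \<Longrightarrow> b \<otimes> (b \<otimes> x) = x"
  "a \<otimes> a = \<one>" "b \<otimes> b = \<one>"
  using involutionsD [OF ab] involutions_cancel_left [OF ab] by simp_all

lemma mult_rotation_pow: "a \<otimes> (a \<otimes> b) [^] n = (a \<otimes> b) [^] (- n) \<otimes> a" for n :: int
proof (induction n rule: int_induct [where k = 0])
  case base
  show ?case by (simp add: involution_pair_simps)
next
  case (step1 n)
  have "a \<otimes> (a \<otimes> b) [^] (n + 1) = (a \<otimes> (a \<otimes> b) [^] n) \<otimes> (a \<otimes> b)"
    by (simp add: involution_pair_simps int_pow_mult m_assoc)
  also have "\<dots> = (a \<otimes> b) [^] (- n) \<otimes> inv (a \<otimes> b) \<otimes> a"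
    by (simp add: step1 involution_pair_simps inv_mult_group m_assoc)
  also have "\<dots> = (a \<otimes> b) [^] (- (n + 1)) \<otimes> a"
    by (simp add: involution_pair_simps int_pow_diff)
  finally show ?case .
next
  case (step2 n)
  have "a \<otimes> (a \<otimes> b) [^] (n - 1) = (a \<otimes> (a \<otimes> b) [^] n) \<otimes> inv (a \<otimes> b)"
    by (simp add: involution_pair_simps int_pow_diff m_assoc)
  also have "\<dots> = (a \<otimes> b) [^] (- n) \<otimes> (a \<otimes> b) \<otimes> a"
    by (simp add: step2 involution_pair_simps inv_mult_group m_assoc)
  also have "\<dots> = (a \<otimes> b) [^] (- n + 1) \<otimes> a"
    using int_pow_mult [of "a \<otimes> b" "- n" 1] by (simp add: involution_pair_simps)
  finally show ?case by simp
qed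

lemma dihedral_elt_closed: "dihedral_elt a b i \<in> carrier G"
  by (simp add: dihedral_elt_def involution_pair_simps)

lemma dihedral_elt_0: "dihedral_elt a b 0 = \<one>"
  and dihedral_elt_1: "dihedral_elt a b 1 = a"
  and dihedral_elt_minus_1: "dihedral_elt a b (- 1) = b"
  by (simp_all add: dihedral_elt_def involution_pair_simps int_pow_neg inv_mult_group m_assoc)

lemma dihedral_elt_odd_mult:
  assumes "odd k"
  shows "dihedral_elt a b k \<otimes> dihedral_elt a b i = dihedral_elt a b (k - i)"
proof -
  obtain m where k: "k = 2 * m + 1" using assms by (rule oddE)
  have refl_mult: "(a \<otimes> b) [^] m \<otimes> a \<otimes> (a \<otimes> b) [^] n = (a \<otimes> b) [^] (m - n) \<otimes> a" for n :: int
  proof -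
    have "(a \<otimes> b) [^] m \<otimes> a \<otimes> (a \<otimes> b) [^] n = (a \<otimes> b) [^] m \<otimes> (a \<otimes> b) [^] (- n) \<otimes> a"
      using mult_rotation_pow [of n] by (simp add: involution_pair_simps m_assoc)
    then show ?thesis by (simp add: involution_pair_simps flip: int_pow_mult)
  qed
  show ?thesis
  proof (cases "even i")
    case True
    then obtain n where "i = 2 * n" by (rule evenE)
    moreover from this have "(k - i) div 2 = m - n" "odd (k - i)" by (auto simp: k)
    ultimately show ?thesis by (simp add: dihedral_elt_def k refl_mult)
  next
    case False
    then obtain n where i: "i = 2 * n + 1" by (rule oddE)
    have "(a \<otimes> b) [^] m \<otimes> a \<otimes> ((a \<otimes> b) [^] n \<otimes> a) = (a \<otimes> b) [^] (m - n)"
      using refl_mult [of n] by (simp add: involution_pair_simps flip: m_assoc) (simp add: involution_pair_simps m_assoc)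
    then show ?thesis by (simp add: dihedral_elt_def k i)
  qed
qed

lemma dihedral_elt_sgn_mult:
  "i \<noteq> 0 \<Longrightarrow> dihedral_elt a b i = dihedral_elt a b (sgn i) \<otimes> dihedral_elt a b (sgn i - i)"
  by (simp add: dihedral_elt_odd_mult sgn_if)

lemma dihedral_elt_word:
  "\<exists>ws\<in>lists {a, b}. length ws = nat \<bar>i\<bar> \<and> wprod G ws = dihedral_elt a b i"
proof (induction "nat \<bar>i\<bar>" arbitrary: i)
  case 0
  then show ?case by (intro bexI [of _ "[]"]) (auto simp: dihedral_elt_0)
next
  case (Suc n)
  then have i: "i \<noteq> 0" and n: "n = nat \<bar>sgn i - i\<bar>" by (auto simp: sgn_if)
  obtain ws where "ws \<in> lists {a, b}" "length ws = n" "wprod G ws = dihedral_elt a b (sgn i - i)"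
    using Suc.hyps(1) [OF n] n by metis
  moreover have "dihedral_elt a b (sgn i) \<in> {a, b}"
    using i by (auto simp: sgn_if dihedral_elt_1 dihedral_elt_minus_1)
  ultimately show ?case
    using Suc.hyps(2) i dihedral_elt_sgn_mult
    by (intro bexI [of _ "dihedral_elt a b (sgn i) # ws"]) auto
qed

lemma dihedral_elt_in_generate: "dihedral_elt a b i \<in> generate G {a, b}"
  and cox_len_dihedral_elt_le: "cox_len G {a, b} (dihedral_elt a b i) \<le> nat \<bar>i\<bar>"
proof -
  obtain ws where ws: "ws \<in> lists {a, b}" "length ws = nat \<bar>i\<bar>" "wprod G ws = dihedral_elt a b i"
    using dihedral_elt_word by blast
  show "dihedral_elt a b i \<in> generate G {a, b}"
    unfolding generate_eq_wprod [OF ab] using ws(1,3) by (metis image_eqI)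
  show "cox_len G {a, b} (dihedral_elt a b i) \<le> nat \<bar>i\<bar>"
    using cox_len_wprod_le [OF ws(1)] ws(2,3) by simp
qed

lemma wprod_eq_dihedral_elt:
  "ws \<in> lists {a, b} \<Longrightarrow> \<exists>i. wprod G ws = dihedral_elt a b i \<and> \<bar>i\<bar> \<le> int (length ws)"
proof (induction ws)
  case Nil
  show ?case by (intro exI [of _ 0]) (simp add: dihedral_elt_0)
next
  case (Cons c ws)
  then obtain i where i: "wprod G ws = dihedral_elt a b i" "\<bar>i\<bar> \<le> int (length ws)" by auto
  from Cons.prems consider "c = dihedral_elt a b 1" | "c = dihedral_elt a b (- 1)"
    using dihedral_elt_1 dihedral_elt_minus_1 by auto
  then show ?case
  proof cases
    case 1
    then have "wprod G (c # ws) = dihedral_elt a b (1 - i)" using i by (simp add: dihedral_elt_odd_mult)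
    then show ?thesis using i(2) by (intro exI [of _ "1 - i"]) auto
  next
    case 2
    then have "wprod G (c # ws) = dihedral_elt a b (- 1 - i)" using i by (simp add: dihedral_elt_odd_mult)
    then show ?thesis using i(2) by (intro exI [of _ "- 1 - i"]) auto
  qed
qed

lemma reduced_dihedral_eltE:
  assumes "w \<in> generate G {a, b}"
  obtains i where "w = dihedral_elt a b i" "\<bar>i\<bar> = int (cox_len G {a, b} w)"
proof -
  obtain ws where "ws \<in> lists {a, b}" "length ws = cox_len G {a, b} w" "wprod G ws = w"
    using ab assms by (rule reduced_wordE)
  then obtain i where "w = dihedral_elt a b i" "\<bar>i\<bar> \<le> int (cox_len G {a, b} w)"
    using wprod_eq_dihedral_elt by metis
  then show ?thesis using that cox_len_dihedral_elt_le [of i] by force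
qed

end

end

section \<open>Dihedral reflection subgroups\<close>

context coxeter
begin

lemma dihedral_elt_in_T:
  assumes ab: "a \<in> T" "b \<in> T" and i: "odd i"
  shows "dihedral_elt a b i \<in> T"
proof -
  let ?D = "dihedral_elt a b"
  have inv: "involutions {a, b}" using ab by (simp add: T_subset_involutions)
  obtain m where m: "i = 2 * m + 1" using i by (rule oddE)
  obtain j c where j: "odd j" and c: "c = 1 \<or> c = - 1" and "i = 2 * j - c"
  proof (cases "even m")
    case True
    then show ?thesis using that [of "m + 1" 1] m by simp
  next
    case False
    then show ?thesis using that [of m "- 1"] m by simp
  qed
  then have "?D i = ?D j \<otimes> (?D c \<otimes> ?D j)"
    by (auto simp: dihedral_elt_odd_mult [OF inv])
  moreover have "?D j = inv (?D j)"
    using j dihedral_elt_odd_mult [OF inv, of j j]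
    by (intro inv_equality [symmetric]) (simp_all add: dihedral_elt_closed [OF inv] dihedral_elt_0 [OF inv])
  ultimately have "?D i = ?D j \<otimes> ?D c \<otimes> inv (?D j)"
    by (simp add: m_assoc dihedral_elt_closed [OF inv])
  moreover have "?D c \<in> T"
    using c ab by (auto simp: dihedral_elt_1 [OF inv] dihedral_elt_minus_1 [OF inv])
  ultimately show ?thesis using T_conj dihedral_elt_closed [OF inv] by metis
qed

lemma even_len_dihedral_elt:
  assumes ab: "a \<in> T" "b \<in> T"
  shows "even (len (dihedral_elt a b i)) \<longleftrightarrow> even i"
proof (cases "even i")
  case True
  have inv: "involutions {a, b}" using ab by (simp add: T_subset_involutions)
  have "dihedral_elt a b i = dihedral_elt a b 1 \<otimes> dihedral_elt a b (1 - i)"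
    by (simp add: dihedral_elt_odd_mult [OF inv])
  then show ?thesis
    using True dihedral_elt_in_T [OF ab] by (simp add: even_len_mult odd_len_T)
next
  case False
  then show ?thesis using dihedral_elt_in_T [OF ab] odd_len_T by blast
qed

lemma odd_len_imp_reflection:
  assumes "a \<in> T" "b \<in> T" "w \<in> generate G {a, b}" "odd (len w)"
  shows "w \<in> T"
proof -
  have "involutions {a, b}" using assms(1,2) by (simp add: T_subset_involutions)
  then obtain i where "w = dihedral_elt a b i"
    using assms(3) by (rule reduced_dihedral_eltE)
  then show ?thesis
    using assms(4) dihedral_elt_in_T [OF assms(1,2)] even_len_dihedral_elt [OF assms(1,2)] by simp
qed

lemma canonical_generators_canonical_gens:
  assumes "R \<subseteq> T"
  shows "canonical_generators G S (canonical_gens G S (generate G R))"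
  by unfold_locales (simp add: generate_canonical_gens [OF assms])

text \<open>As an odd element of a dihedral group \<open>abc\<close> is a reflection, so deleting one letter of the word
  \<open>abc\<close> yields \<open>\<one>\<close>.\<close>

lemma no_three_canonical_gens:
  assumes tr: "t \<in> T" "r \<in> T" and abc: "{a, b, c} \<subseteq> canonical_gens G S (generate G {t, r})"
  shows "a = b \<or> b = c \<or> a = c"
proof -
  define C where "C = canonical_gens G S (generate G {t, r})"
  have R: "{t, r} \<subseteq> T" using tr by simp
  interpret canonical_generators G S C
    unfolding C_def by (rule canonical_generators_canonical_gens [OF R])
  have H: "H = generate G {t, r}" unfolding C_def by (rule generate_canonical_gens [OF R])
  have C: "a \<in> C" "b \<in> C" "c \<in> C" using abc by (auto simp: C_def)
  then have T: "a \<in> T" "b \<in> T" "c \<in> T" and inH: "a \<in> H" "b \<in> H" "c \<in> H"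
    using A_subset_T A_subset_H by auto
  define d where "d = a \<otimes> (b \<otimes> c)"
  have d: "d \<in> H" "odd (len d)" using T inH by (simp_all add: d_def even_len_mult odd_len_T)
  then have dT: "d \<in> T" using odd_len_imp_reflection [OF tr] by (simp add: H)
  have word: "[a, b, c] \<in> lists C" "wprod G [a, b, c] = d"
    using C T by (simp_all add: d_def)
  then have "d \<in> N (wprod G [a, b, c])" using T_in_left_inversions [OF dT] by simp
  from deletion [OF word(1) d(1) this]
  obtain us x vs where split: "[a, b, c] = us @ x # vs" and "d \<otimes> d = wprod G (us @ vs)"
    unfolding word(2) by blast
  then have del: "wprod G (us @ vs) = \<one>" using dT by simp
  have eqI: "y = z" if "y \<otimes> z = \<one>" "y \<in> T" "z \<in> T" for y z
    using inv_equality [OF that(1)] that by simp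
  consider "us @ vs = [b, c]" | "us @ vs = [a, c]" | "us @ vs = [a, b]"
    using split by (auto simp: Cons_eq_append_conv)
  then show ?thesis
    using del T eqI [of b c] eqI [of a c] eqI [of a b] by cases simp_all
qed

lemma ex_two_canonical_gens:
  assumes tr: "t \<in> T" "r \<in> T" "t \<noteq> r"
  shows "\<exists>a b. a \<noteq> b \<and> {a, b} \<subseteq> canonical_gens G S (generate G {t, r})"
proof (rule ccontr)
  define C where "C = canonical_gens G S (generate G {t, r})"
  assume "\<not> ?thesis"
  then have unique: "x = y" if "x \<in> C" "y \<in> C" for x y
    using that unfolding C_def by blast
  have C: "C \<subseteq> T" using canonical_gens_subset [of "generate G {t, r}"] by (simp add: C_def)
  have "w \<in> insert \<one> C" if "w \<in> generate G C" for w
    using that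
  proof (induction rule: generate.induct)
    case (inv c)
    then show ?case using C T_inv [of c] by auto
  next
    case (eng u v)
    then consider "u = \<one>" | "v = \<one>" | "u = v" "v \<in> T" using unique C by blast
    then show ?case using eng.IH C by cases auto
  qed simp_all
  moreover have "generate G C = generate G {t, r}"
    unfolding C_def using tr by (intro generate_canonical_gens) simp
  ultimately have "t \<in> insert \<one> C" "r \<in> insert \<one> C" by (simp_all add: generate.incl)
  then have "t \<in> C" "r \<in> C" using tr one_not_in_T by auto
  then show False using unique tr(3) by blast
qed

end

locale dihedral_subgroup = canonical_generators G S "{a, b}"
  for G (structure) and S a b +
  assumes gens_neq: "a \<noteq> b"
begin

abbreviation D :: "int \<Rightarrow> 'a" where "D \<equiv> dihedral_elt a b"

lemma gens_T: "a \<in> T" "b \<in> T"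
  using A_subset_T by simp_all

lemmas D_in_H [simp] = dihedral_elt_in_generate [OF A_involutions]
  and D_odd_mult = dihedral_elt_odd_mult [OF A_involutions]
  and D_1 = dihedral_elt_1 [OF A_involutions]
  and D_minus_1 = dihedral_elt_minus_1 [OF A_involutions]
  and hlen_D_le = cox_len_dihedral_elt_le [OF A_involutions]
  and reduced_D = reduced_dihedral_eltE [OF A_involutions]
  and D_in_T = dihedral_elt_in_T [OF gens_T]

lemma even_hlen_D: "even (hlen (D i)) \<longleftrightarrow> even i"
  using even_hlen even_len_dihedral_elt [OF gens_T] by simp

lemma reflection_iff_odd_hlen: "w \<in> H \<Longrightarrow> w \<in> T \<longleftrightarrow> odd (hlen w)"
  using odd_len_imp_reflection [OF gens_T] odd_len_T even_hlen by blast

lemma even_hlen_reflection_mult: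
  "c \<in> T \<Longrightarrow> c \<in> H \<Longrightarrow> w \<in> H \<Longrightarrow> even (hlen (c \<otimes> w)) \<longleftrightarrow> odd (hlen w)"
  by (simp add: even_hlen even_len_mult odd_len_T)

lemma hlen_gens_le: "hlen a \<le> 1" "hlen b \<le> 1"
  by (simp_all add: cox_len_generator_le [OF A_involutions, simplified])

lemma dihedral_refl_subgroup_H: "dihedral_refl_subgroup G S H"
  using gens_T gens_neq canonical_gens_eq
  by (auto simp: dihedral_refl_subgroup_def reflection_subgroup_def)

lemma bruhat_arrow_on_H:
  assumes u: "u \<in> H" and v: "v \<in> H" and parity: "even (hlen u) \<noteq> even (hlen v)"
    and less: "hlen u < hlen v"
  shows "bruhat_arrow_on G S H u v"
proof -
  define c where "c = v \<otimes> inv u"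
  have c: "c \<in> H" "c \<otimes> u = v" "inv c = u \<otimes> inv v"
    using u v by (auto simp: c_def m_assoc inv_mult_group)
  have "odd (len c)"
    using u v parity by (simp add: c_def even_len_mult len_inv even_hlen)
  then have cT: "c \<in> T" using c(1) even_hlen reflection_iff_odd_hlen by blast
  then have "len u < len v"
    using not_left_inversion_hlen_iff [OF u _ c(1)] not_left_inversion_iff [of u c] u c(2) less
    by simp
  then have "bruhat_step G S u v" "u \<noteq> v"
    using u v cT c(2) by (auto simp: bruhat_step_def)
  moreover have "u \<otimes> inv v \<in> T" using cT c(3) by (simp flip: c(3))
  ultimately show ?thesis
    using u v by (auto simp: bruhat_arrow_on_def bruhat_arrow_def bruhat_lt_def bruhat_le_def)
qed

lemma reduced_D_pred:
  assumes e: "e = 1 \<or> e = - 1" and reduced: "hlen (D (e * int (Suc n))) = Suc n"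
  shows "hlen (D (- e * int n)) = n"
proof (rule antisym)
  show "hlen (D (- e * int n)) \<le> n"
    using hlen_D_le [of "- e * int n"] e by auto
  have "D (e * int (Suc n)) = D e \<otimes> D (- e * int n)"
    using e by (auto simp: D_odd_mult algebra_simps)
  then have "Suc n \<le> hlen (D e) + hlen (D (- e * int n))"
    using cox_len_mult_le [OF A_involutions, of "D e" "D (- e * int n)"] reduced by simp
  then show "n \<le> hlen (D (- e * int n))"
    using hlen_D_le [of e] e by auto
qed

lemma refl_sq_if_hlen_less:
  assumes t: "t \<in> T" "t \<in> H" and t': "t' \<in> T" "t' \<in> H" and less: "hlen t' < hlen t"
  shows "refl_sq G S t' t"
proof -
  obtain k where k: "t = D k" "\<bar>k\<bar> = int (hlen t)" using t(2) by (rule reduced_D)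
  obtain n where n: "hlen t = Suc n" using less gr0_implies_Suc by (metis gr_implies_not0 neq0_conv)
  define w where "w = D (- sgn k * int n)"
  have "k = sgn k * int (Suc n)" "sgn k = 1 \<or> sgn k = - 1" using k(2) n by (auto simp: sgn_if)
  then have w: "hlen w = n" "w \<in> H" using reduced_D_pred [of "sgn k" n] k(1) n by (auto simp: w_def)
  have parity: "odd (hlen t)" "odd (hlen t')" using t t' reflection_iff_odd_hlen by auto
  then have "hlen t' < n" using less n by (metis even_Suc less_SucE)
  then have "bruhat_arrow_on G S H t' w"
    using w parity n t'(2) by (intro bruhat_arrow_on_H) auto
  moreover have "bruhat_arrow_on G S H w t"
    using w parity n t(2) by (intro bruhat_arrow_on_H) auto
  ultimately have "(bruhat_arrow_on G S H)\<^sup>*\<^sup>* t' t" by auto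
  then show ?thesis
    unfolding refl_sq_def using t t' dihedral_refl_subgroup_H
    by (intro tranclp.r_into_trancl) (auto simp: refl_sq'_def)
qed

lemma generators_chain:
  assumes R: "a \<in> R" "b \<in> R" and e: "e = 1 \<or> e = - 1"
    and reduced: "hlen (D (e * int (n + d))) = n + d"
  shows "hlen (D (e * (- 1) ^ d * int n)) = n \<and>
    (ascent {a, b} (R \<inter> H))\<^sup>*\<^sup>* (D (e * (- 1) ^ d * int n)) (D (e * int (n + d)))"
  using reduced
proof (induction d arbitrary: n)
  case (Suc d)
  define f where "f = e * (- 1) ^ d"
  have f: "f = 1 \<or> f = - 1" using e by (cases "even d") (auto simp: f_def)
  have top: "hlen (D (f * int (Suc n))) = Suc n"
    and chain: "(ascent {a, b} (R \<inter> H))\<^sup>*\<^sup>* (D (f * int (Suc n))) (D (e * int (n + Suc d)))"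
    using Suc.IH [of "Suc n"] Suc.prems by (simp_all add: f_def)
  have pred: "hlen (D (- f * int n)) = n" using f top by (rule reduced_D_pred)
  have "D (f * int (Suc n)) = D f \<otimes> D (- f * int n)"
    using f by (auto simp: D_odd_mult algebra_simps)
  moreover have "D f \<in> R \<inter> H" using f R by (auto simp: D_1 D_minus_1 intro: generate.incl)
  ultimately have "ascent {a, b} (R \<inter> H) (D (- f * int n)) (D (f * int (Suc n)))"
    using pred top by (auto simp: ascent_def)
  then show ?case
    using pred chain by (simp add: f_def converse_rtranclp_into_rtranclp)
qed simp

lemma order_ideal_hlen_less:
  assumes R: "order_ideal_T G S R" and t: "t \<in> R" "t \<in> H" and c: "c \<in> T" "c \<in> H" "hlen c < hlen t"
  shows "c \<in> R"
proof -
  have "t \<in> T" using R t(1) by (auto simp: order_ideal_T_def)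
  then have "refl_sq G S c t" using t(2) c by (intro refl_sq_if_hlen_less)
  then show ?thesis using R t(1) by (auto simp: order_ideal_T_def)
qed

text \<open>Generators alone lead up to \<open>D (e * m)\<close> from the alternating word of length \<open>p + 1\<close> with first
  letter as in \<open>D (- e * p)\<close>, and the reflection \<open>D (- e * (2 * p + 1))\<close> maps \<open>D (- e * p)\<close> to it.\<close>

lemma opposite_words_chain:
  assumes R: "\<And>c. c \<in> T \<Longrightarrow> c \<in> H \<Longrightarrow> hlen c \<le> 2 * p + 1 \<Longrightarrow> c \<in> R"
    and e: "e = 1 \<or> e = - 1" and less: "p < m" and parity: "even m \<longleftrightarrow> even p"
    and reduced: "hlen (D (- e * int p)) = p" "hlen (D (e * int m)) = m"
  shows "(ascent {a, b} (R \<inter> H))\<^sup>*\<^sup>* (D (- e * int p)) (D (e * int m))"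
proof -
  define v g where "v = D (- e * int (p + 1))" and "g = D (- e * int (2 * p + 1))"
  have abR: "a \<in> R" "b \<in> R"
    using R [of a] R [of b] gens_T A_subset_H hlen_gens_le by auto
  have "odd (m - (p + 1))" using parity less by simp
  then have v: "hlen v = p + 1" "(ascent {a, b} (R \<inter> H))\<^sup>*\<^sup>* v (D (e * int m))"
    using generators_chain [OF abR e, of "p + 1" "m - (p + 1)"] less reduced(2)
    by (simp_all add: v_def)
  have "hlen g \<le> 2 * p + 1"
    using hlen_D_le [of "- e * int (2 * p + 1)"] e by (auto simp: g_def)
  moreover have "g \<in> T" "g \<in> H" using e by (auto simp: g_def intro!: D_in_T)
  ultimately have "g \<in> R \<inter> H" using R by simp
  moreover have "v = g \<otimes> D (- e * int p)"
    using e by (auto simp: g_def v_def D_odd_mult algebra_simps)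
  ultimately have "ascent {a, b} (R \<inter> H) (D (- e * int p)) v"
    using v(1) reduced(1) by (auto simp: ascent_def)
  then show ?thesis using v(2) by (rule converse_rtranclp_into_rtranclp)
qed

text \<open>Write \<open>t = D k\<close>, \<open>w = D i\<close> and \<open>trw = D j\<close> with reduced words. If \<open>i\<close> and \<open>j\<close> have opposite
  signs, then the hypotheses, read as \<open>\<bar>i\<bar> < \<bar>k - j\<bar>\<close> and \<open>\<bar>j\<bar> < \<bar>k - i\<bar>\<close>, force
  \<open>\<bar>i\<bar> + \<bar>j\<bar> < \<bar>k\<bar>\<close>.\<close>

lemma dihedral_chain:
  assumes R: "order_ideal_T G S R" and t: "t \<in> R" "t \<in> H" and r: "r \<in> T" "r \<in> H" and w: "w \<in> H"
    and less: "hlen w < hlen (r \<otimes> w)" "hlen (r \<otimes> w) < hlen (t \<otimes> (r \<otimes> w))"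
      "hlen (t \<otimes> (r \<otimes> w)) < hlen (t \<otimes> w)"
  shows "(ascent {a, b} (R \<inter> H))\<^sup>*\<^sup>* w (t \<otimes> (r \<otimes> w))"
proof -
  define q p m where "q = t \<otimes> (r \<otimes> w)" and "p = hlen w" and "m = hlen q"
  have tT: "t \<in> T" using R t by (auto simp: order_ideal_T_def)
  have qH: "q \<in> H" using t r w by (simp add: q_def)
  obtain k where k: "t = D k" "\<bar>k\<bar> = int (hlen t)" using t(2) by (rule reduced_D)
  obtain i where i: "w = D i" "\<bar>i\<bar> = int p" using w unfolding p_def by (rule reduced_D)
  obtain j where j: "q = D j" "\<bar>j\<bar> = int m" using qH unfolding m_def by (rule reduced_D)
  have odd_k: "odd k" using tT t(2) even_hlen_D [of k] by (simp add: reflection_iff_odd_hlen k(1))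
  have parity: "even m \<longleftrightarrow> even p"
    using tT t r w by (simp add: m_def p_def q_def even_hlen_reflection_mult)
  have gap: "p + 2 \<le> m" using less by (simp add: m_def p_def q_def)
  have "r \<otimes> w = t \<otimes> q" using tT r w by (simp add: q_def)
  then have "r \<otimes> w = D (k - j)" using odd_k by (simp add: k(1) j(1) D_odd_mult)
  then have p_less: "int p < \<bar>k - j\<bar>" using less(1) hlen_D_le [of "k - j"] by (simp add: p_def)
  have "t \<otimes> w = D (k - i)" using odd_k by (simp add: k(1) i(1) D_odd_mult)
  then have m_less: "int m < \<bar>k - i\<bar>"
    using less(3) hlen_D_le [of "k - i"] by (simp add: m_def q_def)
  note below = order_ideal_hlen_less [OF R t]
  obtain e where e: "e = 1 \<or> e = - 1" and je: "j = e * int m"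
    using j(2) that [of 1] that [of "- 1"] by linarith
  have reduced: "hlen (D (e * int m)) = m" "hlen (D i) = p"
    using j(1) i(1) je by (simp_all add: m_def p_def)
  have "(ascent {a, b} (R \<inter> H))\<^sup>*\<^sup>* (D i) (D (e * int m))"
  proof (cases "i = e * int p")
    case True
    have "a \<in> R" "b \<in> R"
      using below [of a] below [of b] gens_T A_subset_H hlen_gens_le m_less gap i(2) k(2) by auto
    moreover have "even (m - p)" using parity gap by simp
    ultimately show ?thesis using generators_chain [of R e p "m - p"] e gap True reduced(1) by simp
  next
    case False
    then have ie: "i = - e * int p" using i(2) e by auto
    have "int p + int m < \<bar>k\<bar>" using p_less m_less gap e by (auto simp: je ie)
    then have "2 * p + 1 < hlen t" using k(2) gap by linarith
    then show ?thesis
      unfolding ie using below e gap parity reduced ie by (intro opposite_words_chain) simp_all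
  qed
  then show ?thesis using i(1) j(1) je by (simp add: q_def)
qed

end

lemma (in coxeter) ex_dihedral_subgroup:
  assumes tr: "t \<in> T" "r \<in> T" "t \<noteq> r"
  obtains a b where "dihedral_subgroup G S a b" "generate G {a, b} = generate G {t, r}"
proof -
  define C where "C = canonical_gens G S (generate G {t, r})"
  obtain a b where ab: "a \<noteq> b" "{a, b} \<subseteq> C"
    using ex_two_canonical_gens [OF tr] unfolding C_def by blast
  have "c = a \<or> c = b" if "c \<in> C" for c
    using no_three_canonical_gens [OF tr(1,2), of a b c] ab that unfolding C_def by auto
  then have C: "C = {a, b}" using ab(2) by blast
  have R: "{t, r} \<subseteq> T" using tr by simp
  have "canonical_generators G S {a, b}"
    using canonical_generators_canonical_gens [OF R] by (simp flip: C C_def)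
  then have "dihedral_subgroup G S a b"
    using ab(1) by (simp add: dihedral_subgroup_def dihedral_subgroup_axioms_def)
  moreover have "generate G {a, b} = generate G {t, r}"
    using generate_canonical_gens [OF R] by (simp flip: C C_def)
  ultimately show ?thesis by (rule that)
qed

section \<open>Chains of reflections\<close>

lemma (in canonical_generators) ascents_coset:
  assumes R: "R \<subseteq> T" and y: "y \<in> carrier G" "N y \<inter> H = {}"
    and chain: "(ascent A (R \<inter> H))\<^sup>*\<^sup>* g h"
  shows "(ascent S R)\<^sup>*\<^sup>* (g \<otimes> y) (h \<otimes> y)"
  using chain
proof (induction rule: rtranclp_induct)
  case (step u v)
  then obtain c where c: "u \<in> H" "c \<in> R" "c \<in> H" "v = c \<otimes> u" "hlen u < hlen v"
    by (auto simp: ascent_def)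
  then have "c \<in> T" using R by blast
  then have "ascent S R (u \<otimes> y) (v \<otimes> y)"
    using c y coset_len_less_iff [OF y c(1) _ c(3)]
    by (auto simp: ascent_def generate_S m_assoc intro!: bexI [of _ c])
  with step.IH show ?case by (rule rtranclp.rtrancl_into_rtrancl)
qed simp

context coxeter
begin

lemma reflection_chain:
  assumes R: "order_ideal_T G S R" and t: "t \<in> R" and r: "r \<in> T" and x: "x \<in> carrier G"
    and less: "len x < len (r \<otimes> x)" "len (r \<otimes> x) < len (t \<otimes> (r \<otimes> x))"
      "len (t \<otimes> (r \<otimes> x)) < len (t \<otimes> x)"
  shows "(ascent S R)\<^sup>*\<^sup>* x (t \<otimes> (r \<otimes> x))"
proof -
  have RT: "R \<subseteq> T" and tT: "t \<in> T" using R t by (auto simp: order_ideal_T_def)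
  have "t \<noteq> r" using less tT x by auto
  then obtain a b where "dihedral_subgroup G S a b" and gen: "generate G {a, b} = generate G {t, r}"
    using ex_dihedral_subgroup tT r by blast
  interpret dihedral_subgroup G S a b by fact
  have tH: "t \<in> H" and rH: "r \<in> H" unfolding gen by (auto intro: generate.incl)
  obtain h y where h: "h \<in> H" and y: "y \<in> carrier G" "N y \<inter> H = {}" and hy: "x = h \<otimes> y"
    using H_subgroup x by (rule shortest_coset_repE)
  note transfer = coset_len_less_iff [OF y]
  have "hlen h < hlen (r \<otimes> h)"
    using transfer [OF h r rH] less(1) by (simp add: hy)
  moreover have "hlen (r \<otimes> h) < hlen (t \<otimes> (r \<otimes> h))"
    using transfer [of "r \<otimes> h" t] less(2) h y tT tH rH by (simp add: hy m_assoc)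
  moreover have "hlen (t \<otimes> (r \<otimes> h)) < hlen (t \<otimes> h)"
    using transfer [of "t \<otimes> (r \<otimes> h)" "t \<otimes> r \<otimes> t"] T_conj [OF r, of t] less(3) h y tT r tH rH
    by (simp add: hy m_assoc)
  ultimately have "(ascent {a, b} (R \<inter> H))\<^sup>*\<^sup>* h (t \<otimes> (r \<otimes> h))"
    using dihedral_chain [OF R t tH r rH h] by blast
  then have "(ascent S R)\<^sup>*\<^sup>* (h \<otimes> y) (t \<otimes> (r \<otimes> h) \<otimes> y)"
    by (rule ascents_coset [OF RT y])
  then show ?thesis using h y tH rH by (simp add: hy m_assoc)
qed

lemma bruhat_lt_len:
  assumes "bruhat_lt G S u v" shows "len u < len v"
proof -
  have "(bruhat_step G S)\<^sup>*\<^sup>* u v" "u \<noteq> v"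
    using assms by (auto simp: bruhat_lt_def bruhat_le_def)
  moreover have "u = v \<or> len u < len v" if "(bruhat_step G S)\<^sup>*\<^sup>* u v"
    using that by (induction rule: rtranclp_induct) (auto simp: bruhat_step_def)
  ultimately show ?thesis by blast
qed

lemma ascent_S_iff:
  "ascent S R u v \<longleftrightarrow> u \<in> carrier G \<and> (\<exists>t\<in>R. v = t \<otimes> u) \<and> len u < len v"
  by (simp add: ascent_def generate_S)

lemma LX_step_iff_ascent:
  assumes "R \<subseteq> T" "u \<in> carrier G"
  shows "LX_step G S R u v \<longleftrightarrow> ascent S R u v"
proof
  assume "ascent S R u v"
  then obtain t where t: "t \<in> R" "t \<in> T" "v = t \<otimes> u" "len u < len v"
    using assms(1) by (auto simp: ascent_S_iff)
  then have "bruhat_step G S u v" using assms by (auto simp: bruhat_step_def)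
  then show "LX_step G S R u v"
    using t assms by (auto simp: LX_step_def bruhat_lt_def bruhat_le_def)
qed (use assms bruhat_lt_len in \<open>auto simp: LX_step_def ascent_S_iff\<close>)

lemma ascents_closed:
  assumes "R \<subseteq> T" "(ascent S R)\<^sup>*\<^sup>* u v" "u \<in> carrier G" shows "v \<in> carrier G"
  using assms(2,3) by (induction rule: rtranclp_induct) (use assms(1) in \<open>auto simp: ascent_S_iff\<close>)

lemma le_LX_iff_ascents:
  assumes "R \<subseteq> T" "u \<in> carrier G"
  shows "le_LX G S R u v \<longleftrightarrow> (ascent S R)\<^sup>*\<^sup>* u v"
proof
  assume "le_LX G S R u v"
  moreover have "(ascent S R)\<^sup>*\<^sup>* u v" if "(LX_step G S R)\<^sup>+\<^sup>+ u v"
    using that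
  proof (induction rule: tranclp_induct)
    case (base y)
    then show ?case using LX_step_iff_ascent assms by blast
  next
    case (step y z)
    then show ?case
      using LX_step_iff_ascent [OF assms(1)] ascents_closed [OF assms(1) _ assms(2)]
      by (meson rtranclp.rtrancl_into_rtrancl)
  qed
  ultimately show "(ascent S R)\<^sup>*\<^sup>* u v" by (auto simp: le_LX_def)
next
  assume "(ascent S R)\<^sup>*\<^sup>* u v"
  then show "le_LX G S R u v"
  proof (induction rule: rtranclp_induct)
    case (step y z)
    have "LX_step G S R y z" "len y < len z"
      using step.hyps LX_step_iff_ascent [OF assms(1), of y z] by (auto simp: ascent_S_iff)
    then show ?case using step.IH by (auto simp: le_LX_def)
  qed (simp add: le_LX_def)
qed

lemma refl_sq_len:
  assumes "refl_sq G S t t'" shows "t \<in> T \<and> len t \<le> len t'"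
proof -
  have step: "t \<in> T \<and> len t \<le> len t'" if sq: "refl_sq' G S t t'" for t t'
  proof -
    have "len t \<le> len t'" if "(bruhat_arrow_on G S W')\<^sup>*\<^sup>* t t'" for W'
      using that
    proof (induction rule: rtranclp_induct)
      case (step y z)
      then show ?case
        using bruhat_lt_len [of y z] by (auto simp: bruhat_arrow_on_def bruhat_arrow_def)
    qed simp
    then show ?thesis using sq by (auto simp: refl_sq'_def)
  qed
  show ?thesis
    using assms unfolding refl_sq_def
    by (induction rule: tranclp_induct) (use step in \<open>auto intro: le_trans\<close>)
qed

lemma order_ideal_refl_T_k: "order_ideal_T G S (refl_T_k G S k)"
  unfolding order_ideal_T_def refl_T_k_def by (auto dest!: refl_sq_len)

end

section \<open>Projections to minimal coset representatives\<close>

context coxeter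
begin

definition lower :: "'a \<Rightarrow> 'a \<Rightarrow> 'a" where
  "lower s w = (if len (w \<otimes> s) < len w then w \<otimes> s else w)"

lemma lower_closed: "s \<in> S \<Longrightarrow> w \<in> carrier G \<Longrightarrow> lower s w \<in> carrier G"
  by (simp add: lower_def)

lemma len_lower_le: "len (lower s w) \<le> len w"
  by (simp add: lower_def)

lemma square_chain:
  assumes R: "order_ideal_T G S R" and t: "t \<in> R" and x: "x \<in> carrier G" and s: "s \<in> S"
    and less: "len x < len (x \<otimes> s)" "len x < len (t \<otimes> x)" "len (t \<otimes> x \<otimes> s) < len (t \<otimes> x)"
  shows "(ascent S R)\<^sup>*\<^sup>* x (t \<otimes> x \<otimes> s)"
proof -
  define r where "r = x \<otimes> s \<otimes> inv x"
  have T: "t \<in> T" "r \<in> T" using R t x s T_conj S_subset_T by (auto simp: r_def order_ideal_T_def)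
  have rx: "r \<otimes> x = x \<otimes> s" using x s by (simp add: r_def m_assoc)
  show ?thesis
  proof (cases "t = r")
    case True
    then have "t \<otimes> x \<otimes> s = x" using x s by (simp add: rx m_assoc S_cancel)
    then show ?thesis by simp
  next
    case False
    moreover have "t \<notin> N x" using not_left_inversion_iff [OF x T(1)] less(2) by simp
    ultimately have "t \<notin> N (x \<otimes> s)"
      using left_inversions_mult_S [OF x s less(1)] by (simp add: r_def)
    then have "len (r \<otimes> x) < len (t \<otimes> (r \<otimes> x))"
      using not_left_inversion_iff [of "x \<otimes> s" t] x s T(1) by (simp add: rx)
    then show ?thesis
      using reflection_chain [OF R t T(2) x] less x s T(1) by (simp add: rx m_assoc)
  qed
qed

lemma lower_ascent:
  assumes R: "order_ideal_T G S R" and s: "s \<in> S" and asc: "ascent S R u v"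
  shows "(ascent S R)\<^sup>*\<^sup>* (lower s u) (lower s v)"
proof -
  obtain t where t: "t \<in> R" and u: "u \<in> carrier G" and v: "v = t \<otimes> u" and less: "len u < len v"
    using asc by (auto simp: ascent_S_iff)
  have tT: "t \<in> T" using R t by (auto simp: order_ideal_T_def)
  have vG: "v \<in> carrier G" using u tT by (simp add: v)
  have vs: "v \<otimes> s = t \<otimes> (u \<otimes> s)" and uss: "u \<otimes> s \<otimes> s = u" using u s tT by (simp_all add: v m_assoc)
  note lens = len_mult_S [OF u s] len_mult_S [OF vG s]
  consider (none) "len u < len (u \<otimes> s)" "len v < len (v \<otimes> s)"
    | (both) "len (u \<otimes> s) < len u" "len (v \<otimes> s) < len v"
    | (left) "len (u \<otimes> s) < len u" "len v < len (v \<otimes> s)"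
    | (right) "len u < len (u \<otimes> s)" "len (v \<otimes> s) < len v"
    using lens by linarith
  then show ?thesis
  proof cases
    case none
    then show ?thesis using asc by (simp add: lower_def)
  next
    case both
    then have "ascent S R (u \<otimes> s) (v \<otimes> s)"
      unfolding ascent_S_iff using t u s vs lens less by auto
    then show ?thesis using both by (simp add: lower_def)
  next
    case left
    have "(ascent S R)\<^sup>*\<^sup>* (u \<otimes> s) (t \<otimes> (u \<otimes> s) \<otimes> s)"
      using u s tT uss v vs left less by (intro square_chain [OF R t]) (simp_all add: m_assoc)
    then show ?thesis using left u s tT uss by (simp add: lower_def v m_assoc)
  next
    case right
    have "(ascent S R)\<^sup>*\<^sup>* u (v \<otimes> s)"
      using square_chain [OF R t u s] right less by (simp add: v)
    then show ?thesis using right by (simp add: lower_def)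
  qed
qed

lemma lower_mono:
  assumes "order_ideal_T G S R" "s \<in> S" "(ascent S R)\<^sup>*\<^sup>* u v"
  shows "(ascent S R)\<^sup>*\<^sup>* (lower s u) (lower s v)"
  using assms(3)
  by (induction rule: rtranclp_induct) (auto intro: rtranclp_trans lower_ascent [OF assms(1,2)])

end

locale parabolic_subgroup = coxeter +
  fixes J :: "'a set"
  assumes J_subset_S: "J \<subseteq> S"

sublocale parabolic_subgroup \<subseteq> canonical_generators G S J
proof
  show "J \<subseteq> canonical_gens G S (generate G J)"
  proof
    fix s assume "s \<in> J"
    then have "s \<in> T" "s \<in> generate G J" "N s = {s}"
      using J_subset_S S_subset_T left_inversions_S by (auto intro: generate.incl)
    then show "s \<in> canonical_gens G S (generate G J)" by (simp add: canonical_gens_iff)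
  qed
qed

context parabolic_subgroup
begin

abbreviation min_reps :: "'a set" where "min_reps \<equiv> min_coset_reps G S J"
abbreviation P :: "'a \<Rightarrow> 'a" where "P \<equiv> proj_J G S J"

lemma min_coset_reps_iff: "w \<in> min_reps \<longleftrightarrow> w \<in> carrier G \<and> N (inv w) \<inter> H = {}"
proof (intro iffI conjI)
  assume w: "w \<in> min_reps"
  then show wG: "w \<in> carrier G" by (simp add: min_coset_reps_def)
  have "s \<notin> N (inv w)" if s: "s \<in> J" for s
    using w s left_inversion_inv_iff [OF wG, of s] A_subset_T by (force simp: min_coset_reps_def)
  then show "N (inv w) \<inter> H = {}"
    using ex_canonical_left_inversion [OF H_subgroup, of "inv w"] wG canonical_gens_eq by auto
next
  assume w: "w \<in> carrier G \<and> N (inv w) \<inter> H = {}"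
  have "len w < len (w \<otimes> s)" if s: "s \<in> J" for s
  proof -
    have "\<not> len (w \<otimes> s) < len w" using w s A_subset_H A_subset_T left_inversion_inv_iff by blast
    then show ?thesis using len_mult_S [of w s] w s J_subset_S by auto
  qed
  then show "w \<in> min_reps" using w by (simp add: min_coset_reps_def)
qed

lemma min_coset_reps_unique:
  assumes "x \<in> min_reps" "x' \<in> min_reps" "y \<in> H" "x = x' \<otimes> y"
  shows "x = x'"
proof -
  have "N (inv x) \<inter> H = {}" "N (inv x') \<inter> H = {}" "x' \<in> carrier G"
    using assms(1,2) by (simp_all add: min_coset_reps_iff)
  moreover from this have "inv x = inv y \<otimes> inv x'" using assms(3,4) by (simp add: inv_mult_group)
  ultimately have "inv y = \<one>" using shortest_coset_rep_unique [of "inv x'" "inv y"] assms(3) by simp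
  then have "y = \<one>" using assms(3) by (metis H_closed inv_inv inv_one)
  then show ?thesis using assms(4) \<open>x' \<in> carrier G\<close> by simp
qed

lemma parabolic_factorization:
  assumes "w \<in> carrier G"
  shows "\<exists>x\<in>min_reps. \<exists>y\<in>H. w = x \<otimes> y \<and> len w = len x + len y"
  using assms
proof (induction "len w" arbitrary: w rule: less_induct)
  case less
  show ?case
  proof (cases "w \<in> min_reps")
    case True
    then show ?thesis using less.prems
      by (intro bexI [of _ w] bexI [of _ \<one>]) (auto intro: generate.one)
  next
    case False
    then obtain s where s: "s \<in> J" "\<not> len w < len (w \<otimes> s)"
      using less.prems by (auto simp: min_coset_reps_def)
    then have sS: "s \<in> S" and sH: "s \<in> H" using J_subset_S A_subset_H by auto
    have ws: "w \<otimes> s \<in> carrier G" "len w = len (w \<otimes> s) + 1"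
      using len_mult_S [OF less.prems sS] s(2) less.prems sS by auto
    then obtain x y where x: "x \<in> min_reps" and y: "y \<in> H"
      and xy: "w \<otimes> s = x \<otimes> y" "len (w \<otimes> s) = len x + len y"
      using less.hyps [of "w \<otimes> s"] by auto
    have xG: "x \<in> carrier G" using x by (simp add: min_coset_reps_def)
    have "w = w \<otimes> s \<otimes> s" using less.prems sS by (simp add: m_assoc)
    also have "\<dots> = x \<otimes> (y \<otimes> s)" using xG y sS by (simp add: xy(1) m_assoc)
    finally have w: "w = x \<otimes> (y \<otimes> s)" .
    then have "len w \<le> len x + len (y \<otimes> s)"
      using cox_len_mult_le [OF S_involutions, of x "y \<otimes> s"] xG y sS by (simp add: generate_S)
    moreover have "len (y \<otimes> s) \<le> len y + 1" using len_mult_S [of y s] y sS by auto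
    ultimately have "len w = len x + len (y \<otimes> s)" using ws(2) xy(2) by simp
    then show ?thesis using w x y sH by (metis H_mult)
  qed
qed

lemma proj_J_eqI:
  assumes x: "x \<in> min_reps" and y: "y \<in> H" and w: "w = x \<otimes> y"
  shows "P w = x"
proof -
  have xG: "x \<in> carrier G" using x by (simp add: min_coset_reps_def)
  have unique: "x' = x" if x': "x' \<in> min_reps" and y': "y' \<in> H" and w': "w = x' \<otimes> y'" for x' y'
  proof (rule min_coset_reps_unique [OF x' x])
    have "x' = x' \<otimes> y' \<otimes> inv y'" using x' y' by (simp add: min_coset_reps_def m_assoc)
    then show "x' = x \<otimes> (y \<otimes> inv y')" using xG y y' by (simp add: w m_assoc flip: w')
    show "y \<otimes> inv y' \<in> H" using y y' by simp
  qed
  obtain x' y' where "x' \<in> min_reps" "y' \<in> H" "w = x' \<otimes> y'" "len w = len x' + len y'"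
    using parabolic_factorization [of w] xG y w by auto
  with unique show ?thesis
    unfolding proj_J_def by (intro the_equality) blast+
qed

lemma proj_J_min_rep: "w \<in> min_reps \<Longrightarrow> P w = w"
  by (rule proj_J_eqI [of _ \<one>]) (auto simp: min_coset_reps_def intro: generate.one)

lemma proj_J_mult:
  assumes "w \<in> carrier G" "h \<in> H"
  shows "P (w \<otimes> h) = P w"
proof -
  obtain x y where xy: "x \<in> min_reps" "y \<in> H" "w = x \<otimes> y"
    using parabolic_factorization [OF assms(1)] by blast
  then have "w \<otimes> h = x \<otimes> (y \<otimes> h)" using assms by (simp add: min_coset_reps_def m_assoc)
  then have "P (w \<otimes> h) = x" using xy assms by (intro proj_J_eqI) simp_all
  moreover have "P w = x" using xy by (intro proj_J_eqI)
  ultimately show ?thesis by simp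
qed

lemma proj_J_lower: "w \<in> carrier G \<Longrightarrow> s \<in> J \<Longrightarrow> P (lower s w) = P w"
  using A_subset_H by (auto simp: lower_def proj_J_mult)

lemma proj_J_ascents:
  assumes "order_ideal_T G S R" "u \<in> carrier G" "v \<in> carrier G" "(ascent S R)\<^sup>*\<^sup>* u v"
  shows "(ascent S R)\<^sup>*\<^sup>* (P u) (P v)"
  using assms(2-)
proof (induction "len u + len v" arbitrary: u v rule: less_induct)
  case less
  show ?case
  proof (cases "u \<in> min_reps \<and> v \<in> min_reps")
    case True
    then show ?thesis using less.prems(3) by (simp add: proj_J_min_rep)
  next
    case False
    then obtain s where s: "s \<in> J" "s \<in> S" and "\<not> len u < len (u \<otimes> s) \<or> \<not> len v < len (v \<otimes> s)"
      using less.prems(1,2) J_subset_S by (auto simp: min_coset_reps_def)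
    then have "len (u \<otimes> s) < len u \<or> len (v \<otimes> s) < len v"
      using len_mult_S less.prems(1,2) by force
    then have shorter: "len (lower s u) + len (lower s v) < len u + len v"
      using len_lower_le [of s u] len_lower_le [of s v] by (auto simp: lower_def)
    have "(ascent S R)\<^sup>*\<^sup>* (P (lower s u)) (P (lower s v))"
      using less.prems s lower_closed lower_mono [OF assms(1) s(2)]
      by (intro less.hyps [OF shorter]) blast+
    then show ?thesis using less.prems(1,2) s(1) by (simp add: proj_J_lower)
  qed
qed

lemma proj_J_mono:
  assumes R: "order_ideal_T G S R" and uv: "u \<in> carrier G" "v \<in> carrier G" "le_LX G S R u v"
  shows "le_LX G S R (P u) (P v)"
proof -
  have RT: "R \<subseteq> T" using R by (simp add: order_ideal_T_def)
  have "P u \<in> carrier G"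
    using parabolic_factorization [OF uv(1)] proj_J_eqI by (auto simp: min_coset_reps_def)
  then show ?thesis
    using proj_J_ascents [OF R uv(1,2)] uv(1,3) le_LX_iff_ascents [OF RT] by blast
qed

end

theorem theorem3p8:
  fixes G :: "('a, 'b) monoid_scheme" and S J :: "'a set"
  assumes "coxeter_system G S" and "J \<subseteq> S"
  shows "(\<forall>R. order_ideal_T G S R \<longrightarrow>
            (\<forall>u \<in> carrier G. \<forall>v \<in> carrier G. le_LX G S R u v \<longrightarrow>
               le_LX G S R (proj_J G S J u) (proj_J G S J v)))
       \<and> (\<forall>k::nat. \<forall>u \<in> carrier G. \<forall>v \<in> carrier G. le_Lk G S k u v \<longrightarrow>
               le_Lk G S k (proj_J G S J u) (proj_J G S J v))"
proof -
  interpret parabolic_subgroup G S J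
    using assms by unfold_locales
  show ?thesis
    using proj_J_mono order_ideal_refl_T_k unfolding le_Lk_def by blast
qed

end
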